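(* Let $F$ and $G$ be nonempty graphs without isolated vertices such that there exists a graph homomorphism from $G$ to $F$. Then $\mathrm{ex}_F(n,G)=o(n^2)$ as $n\to\infty$.
   Context: All graphs are simple. $\mathrm{ex}_F(n,G)$ is the maximum $k$ such that there exist $k$ pairwise edge-disjoint subgraphs $F_1,\dots,F_k$ of $K_n$, each isomorphic to $F$, such that $\bigcup_i F_i$ contains no subgraph $G'$ isomorphic to $G$ with $|E(G')\cap E(F_i)|\le 1$ for every $i$. *)

theory Defs
  imports Complex_Main "HOL-Library.Landau_Symbols"
begin

type_synonym 'a ugraph = "'a set \<times> 'a set set"

abbreviation verts :: "'a ugraph \<Rightarrow> 'a set" where
  "verts G \<equiv> fst G"

abbreviation edges :: "'a ugraph \<Rightarrow> 'a set set" where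
  "edges G \<equiv> snd G"

definition simple_graph :: "'a ugraph \<Rightarrow> bool" where
  "simple_graph G \<longleftrightarrow>
     finite (verts G) \<and> (\<forall>e\<in>edges G. e \<subseteq> verts G \<and> card e = 2)"

definition no_isolated_vertices :: "'a ugraph \<Rightarrow> bool" where
  "no_isolated_vertices G \<longleftrightarrow> (\<forall>v\<in>verts G. \<exists>e\<in>edges G. v \<in> e)"

definition graph_hom :: "('a \<Rightarrow> 'b) \<Rightarrow> 'a ugraph \<Rightarrow> 'b ugraph \<Rightarrow> bool" where
  "graph_hom f G H \<longleftrightarrow>
     f ` verts G \<subseteq> verts H \<and>
     (\<forall>u v. {u, v} \<in> edges G \<longrightarrow> {f u, f v} \<in> edges H)"

definition graph_iso :: "'a ugraph \<Rightarrow> 'b ugraph \<Rightarrow> bool" where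
  "graph_iso G H \<longleftrightarrow>
     (\<exists>f. bij_betw f (verts G) (verts H) \<and>
          (\<forall>u\<in>verts G. \<forall>v\<in>verts G. {u, v} \<in> edges G \<longleftrightarrow> {f u, f v} \<in> edges H))"

text \<open>Subgraphs are not required to be induced.\<close>

definition subgraph :: "'a ugraph \<Rightarrow> 'a ugraph \<Rightarrow> bool" where
  "subgraph H G \<longleftrightarrow> simple_graph H \<and> verts H \<subseteq> verts G \<and> edges H \<subseteq> edges G"

definition complete_graph :: "nat \<Rightarrow> nat ugraph" where
  "complete_graph n = ({..<n}, {e. e \<subseteq> {..<n} \<and> card e = 2})"

definition graph_Union :: "nat \<Rightarrow> (nat \<Rightarrow> 'a ugraph) \<Rightarrow> 'a ugraph" where
  "graph_Union k Fs = (\<Union>i<k. verts (Fs i), \<Union>i<k. edges (Fs i))"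

text \<open>The copies of \<open>F\<close> are \<open>Fs 0, \<dots>, Fs (k - 1)\<close>; the values of \<open>Fs\<close> at other
  indices are irrelevant.\<close>

definition admissible_family ::
    "'a ugraph \<Rightarrow> nat \<Rightarrow> 'b ugraph \<Rightarrow> nat \<Rightarrow> (nat \<Rightarrow> nat ugraph) \<Rightarrow> bool" where
  "admissible_family F n G k Fs \<longleftrightarrow>
     (\<forall>i<k. subgraph (Fs i) (complete_graph n) \<and> graph_iso (Fs i) F) \<and>
     (\<forall>i<k. \<forall>j<k. i \<noteq> j \<longrightarrow> edges (Fs i) \<inter> edges (Fs j) = {}) \<and>
     \<not> (\<exists>G'. subgraph G' (graph_Union k Fs) \<and> graph_iso G' G \<and>
             (\<forall>i<k. card (edges G' \<inter> edges (Fs i)) \<le> 1))"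

definition ex_family :: "'a ugraph \<Rightarrow> nat \<Rightarrow> 'b ugraph \<Rightarrow> nat" where
  "ex_family F n G = Max {k. \<exists>Fs. admissible_family F n G k Fs}"

text \<open>The maximum is attained whenever \<open>F\<close> has an edge and \<open>G\<close> is nonempty: the
  set of admissible sizes contains 0 and is finite.\<close>

lemma zero_admissible:
  assumes "verts G \<noteq> {}"
  shows "admissible_family F n G 0 Fs"
  using assms
  by (auto simp: admissible_family_def graph_Union_def subgraph_def graph_iso_def bij_betw_def)

lemma finite_admissible:
  assumes F: "simple_graph F" "edges F \<noteq> {}"
  shows "finite {k. \<exists>Fs. admissible_family F n G k Fs}"
proof -
  let ?E = "edges (complete_graph n)"
  have finE: "finite ?E"
    by (rule finite_subset[of _ "Pow {..<n}"]) (auto simp: complete_graph_def)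
  have "k \<le> card ?E" if adm: "admissible_family F n G k Fs" for k Fs
  proof -
    have sub: "edges (Fs i) \<subseteq> ?E" and iso: "graph_iso (Fs i) F" if "i < k" for i
      using adm that by (simp_all add: admissible_family_def subgraph_def)
    have disj: "edges (Fs i) \<inter> edges (Fs j) = {}" if "i < k" "j < k" "i \<noteq> j" for i j
      using adm that by (simp add: admissible_family_def)
    have ne: "edges (Fs i) \<noteq> {}" if i: "i < k" for i
    proof -
      obtain f where bij: "bij_betw f (verts (Fs i)) (verts F)"
        and f: "\<forall>u\<in>verts (Fs i). \<forall>v\<in>verts (Fs i). {u, v} \<in> edges (Fs i) \<longleftrightarrow> {f u, f v} \<in> edges F"
        using iso[OF i] unfolding graph_iso_def by auto
      obtain d where d: "d \<in> edges F"
        using F(2) by auto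
      then have "card d = 2" "d \<subseteq> verts F"
        using F(1) by (simp_all add: simple_graph_def)
      then obtain x y where xy: "d = {x, y}" "x \<in> verts F" "y \<in> verts F"
        by (auto simp: card_2_iff)
      moreover have "f ` verts (Fs i) = verts F"
        using bij by (simp add: bij_betw_def)
      ultimately obtain u v where "u \<in> verts (Fs i)" "v \<in> verts (Fs i)" "x = f u" "y = f v"
        by (metis imageE)
      then have "{u, v} \<in> edges (Fs i)"
        using f d xy(1) by simp
      then show ?thesis
        by auto
    qed
    define e where "e i = (SOME e. e \<in> edges (Fs i))" for i
    have e: "e i \<in> edges (Fs i)" if i: "i < k" for i
      using ne[OF i] unfolding e_def by (simp add: some_in_eq)
    have "inj_on e {..<k}"
    proof (rule inj_onI)
      fix i j assume "i \<in> {..<k}" "j \<in> {..<k}" "e i = e j"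
      then show "i = j"
        using e[of i] e[of j] disj[of i j] by auto
    qed
    moreover have "e ` {..<k} \<subseteq> ?E"
      using e sub by auto
    ultimately show ?thesis
      using card_inj_on_le[OF _ _ finE] by fastforce
  qed
  then have "{k. \<exists>Fs. admissible_family F n G k Fs} \<subseteq> {..card ?E}"
    by blast
  then show ?thesis
    using finite_subset by blast
qed

end

theory Submission imports Defs
begin

text \<open>Suppose there are \<open>\<epsilon>n\<^sup>2\<close> edge-disjoint copies of \<open>F\<close>. Szemeredi's regularity lemma, applied to
  the union of the copies, leaves fewer than \<open>\<epsilon>n\<^sup>2\<close> edges outside dense regular pairs of large cells.
  By edge-disjointness some copy of \<open>F\<close> avoids all of them, and composing it with a homomorphism
  \<open>G \<rightarrow> F\<close> assigns to each vertex of \<open>G\<close> a cell. The vertices of \<open>G\<close> are then embedded greedily into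
  their cells, where each step avoids the few vertices that would put two edges into the same copy.\<close>

section \<open>Szemeredi's regularity lemma\<close>

text \<open>The copy avoiding all bad edges cannot itself serve as the image of \<open>G\<close>:
  the homomorphism need not be injective, and all edges of \<open>G\<close> would land in one copy.
  That copy only assigns cells; the edges of the final embedding come from whichever copies supply
  them. The rainbow condition is paid for inside the greedy embedding, where every step has linearly
  many candidates. An edge determines its copy, so an edge already embedded bans at most
  \<open>f\<close> vertices. Two nonadjacent vertices, however, can share linearly many copies: if
  \<open>F\<close> is a path with two edges, the copies u - x - v over all x are edge-disjoint, and
  every vertex is dangerous for the pair u, v. Hence the embedding also keeps the chosen vertices
  spread: every two of them have a \<open>joint\<close> of size at most \<eta> n. This is cheap. At
  most n copies pass through u, so the sets \<open>joint u v\<close> have total size at most f^2 n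
  over all v, and only f^2 / \<eta> vertices v are bad for u, a number free of n. The constant
  \<eta> is then taken small against the share of candidates that a greedy step can spare.\<close>

definition dens :: "('a \<times> 'a) set \<Rightarrow> 'a set \<Rightarrow> 'a set \<Rightarrow> real" where
  "dens E A B = card (E \<inter> A \<times> B) / (card A * card B)"

definition regular_pair :: "real \<Rightarrow> ('a \<times> 'a) set \<Rightarrow> 'a set \<Rightarrow> 'a set \<Rightarrow> bool" where
  "regular_pair \<epsilon> E A B \<longleftrightarrow>
     (\<forall>A' B'. A' \<subseteq> A \<longrightarrow> B' \<subseteq> B \<longrightarrow> real (card A') \<ge> \<epsilon> * real (card A) \<longrightarrow> real (card B') \<ge> \<epsilon> * real (card B) \<longrightarrow>
        \<bar>dens E A' B' - dens E A B\<bar> \<le> \<epsilon>)"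

text \<open>A partition of \<open>V\<close> is encoded by a family \<open>S\<close> of sets, its
  parts being the atoms that \<open>S\<close> cuts out of \<open>V\<close>. Refining the partition
  then just means enlarging \<open>S\<close>, and \<open>card S\<close> controls the number of
  parts.\<close>

definition cell :: "'a set set \<Rightarrow> 'a set \<Rightarrow> 'a \<Rightarrow> 'a set" where
  "cell S V x = {z \<in> V. \<forall>T\<in>S. x \<in> T \<longleftrightarrow> z \<in> T}"

lemma cell_subset: "cell S V x \<subseteq> V"
  by (auto simp: cell_def)

lemma self_in_cell: "x \<in> V \<Longrightarrow> x \<in> cell S V x"
  by (auto simp: cell_def)

lemma cell_eqI: "z \<in> cell S V x \<Longrightarrow> cell S V z = cell S V x"
  by (auto simp: cell_def)

lemma cell_antimono: "S \<subseteq> S' \<Longrightarrow> cell S' V x \<subseteq> cell S V x"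
  by (auto simp: cell_def)

lemma cell_subset_member: "T \<in> S \<Longrightarrow> x \<in> T \<Longrightarrow> cell S V x \<subseteq> T"
  by (auto simp: cell_def)

text \<open>A cell is determined by the members of \<open>S\<close> that contain its point, so the
  cells are indexed by subsets of \<open>S\<close>.\<close>

lemma card_cells_le:
  assumes "finite S"
  shows "finite (cell S V ` X)" "card (cell S V ` X) \<le> 2 ^ card S"
proof -
  have "cell S V x = (\<lambda>U. {z \<in> V. {T\<in>S. z \<in> T} = U}) {T\<in>S. x \<in> T}" for x
    by (auto simp: cell_def)
  then have sub: "cell S V ` X \<subseteq> (\<lambda>U. {z \<in> V. {T\<in>S. z \<in> T} = U}) ` Pow S"
    by auto
  then show "finite (cell S V ` X)"
    using assms finite_surj[of "Pow S"] by blast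
  have "card (cell S V ` X) \<le> card (Pow S)"
    by (rule surj_card_le[OF _ sub]) (use assms in auto)
  then show "card (cell S V ` X) \<le> 2 ^ card S"
    using assms by (simp add: card_Pow)
qed

text \<open>Map a pair of points to its pair of cells: on saturated \<open>X\<close> and
  \<open>Y\<close> the fibres are exactly the products of cells. Pointwise sums are compared block
  by block in this way throughout.\<close>

lemma sum_cells:
  fixes h :: "'a \<times> 'a \<Rightarrow> real"
  assumes V: "finite V" and X: "X \<subseteq> V" and Y: "Y \<subseteq> V"
    and satX: "\<And>x. x \<in> X \<Longrightarrow> cell S V x \<subseteq> X" and satY: "\<And>y. y \<in> Y \<Longrightarrow> cell S V y \<subseteq> Y"
  shows "sum h (X \<times> Y) = (\<Sum>(A, B) \<in> cell S V ` X \<times> cell S V ` Y. sum h (A \<times> B))"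
proof -
  let ?g = "\<lambda>(x, y). (cell S V x, cell S V y)"
  have fin: "finite X" "finite Y"
    using finite_subset[OF X V] finite_subset[OF Y V] by simp_all
  have "sum h (X \<times> Y) =
      (\<Sum>c \<in> cell S V ` X \<times> cell S V ` Y. sum h {p \<in> X \<times> Y. ?g p = c})"
    by (rule sum.group[symmetric]) (use fin in auto)
  also have "\<dots> = (\<Sum>(A, B) \<in> cell S V ` X \<times> cell S V ` Y. sum h (A \<times> B))"
  proof (rule sum.cong[OF refl])
    fix c assume "c \<in> cell S V ` X \<times> cell S V ` Y"
    then obtain x y where c: "c = (cell S V x, cell S V y)" and xy: "x \<in> X" "y \<in> Y"
      by auto
    have fib: "{z \<in> Z. cell S V z = cell S V x} = cell S V x"
      if Z: "Z \<subseteq> V" "cell S V x \<subseteq> Z" for x Z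
    proof (intro subset_antisym subsetI)
      fix z assume "z \<in> {z \<in> Z. cell S V z = cell S V x}"
      then show "z \<in> cell S V x"
        using Z(1) self_in_cell[of z V S] by auto
    next
      fix z assume z: "z \<in> cell S V x"
      then show "z \<in> {z \<in> Z. cell S V z = cell S V x}"
        using Z(2) cell_eqI[OF z] by auto
    qed
    have "{p \<in> X \<times> Y. ?g p = c} =
        {z \<in> X. cell S V z = cell S V x} \<times> {z \<in> Y. cell S V z = cell S V y}"
      by (auto simp: c)
    also have "\<dots> = cell S V x \<times> cell S V y"
      using fib[OF X satX[OF xy(1)]] fib[OF Y satY[OF xy(2)]] by simp
    finally show "sum h {p \<in> X \<times> Y. ?g p = c} = (case c of (A, B) \<Rightarrow> sum h (A \<times> B))"
      by (simp add: c)
  qed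
  finally show ?thesis .
qed

text \<open>For an empty side, division by zero makes \<open>dens\<close> equal to 0, which agrees
  with the count; the identity covers that case as well.\<close>

lemma dens_mult:
  assumes "finite A" "finite B"
  shows "dens E A B * (card A * card B) = card (E \<inter> A \<times> B)"
  using assms by (auto simp: dens_def)

lemma dens_bounds:
  assumes "finite A" "finite B"
  shows "0 \<le> dens E A B" "dens E A B \<le> 1"
proof -
  show "0 \<le> dens E A B"
    by (simp add: dens_def)
  have "card (E \<inter> A \<times> B) \<le> card (A \<times> B)"
    by (rule card_mono) (use assms in auto)
  then have "real (card (E \<inter> A \<times> B)) \<le> real (card A * card B)"
    by (simp add: card_cartesian_product flip: of_nat_mult)
  then show "dens E A B \<le> 1"
    unfolding dens_def by (metis divide_le_eq_1 of_nat_0_le_iff order_le_less of_nat_mult)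
qed

text \<open>The conditional expectation of the indicator of \<open>E\<close> given the product
  partition. As a function of points rather than of blocks, it can be compared across different
  families \<open>S\<close>.\<close>

definition cell_dens :: "('a \<times> 'a) set \<Rightarrow> 'a set set \<Rightarrow> 'a set \<Rightarrow> 'a \<times> 'a \<Rightarrow> real" where
  "cell_dens E S V = (\<lambda>(x, y). dens E (cell S V x) (cell S V y))"

lemma cell_dens_const:
  assumes "p \<in> cell S V x \<times> cell S V y"
  shows "cell_dens E S V p = dens E (cell S V x) (cell S V y)"
  using assms cell_eqI[of _ S V] unfolding cell_dens_def by fastforce

text \<open>Averaging over blocks preserves sums over unions of blocks.\<close>

lemma sum_cell_dens:
  assumes V: "finite V" and X: "X \<subseteq> V" and Y: "Y \<subseteq> V"
    and satX: "\<And>x. x \<in> X \<Longrightarrow> cell S V x \<subseteq> X" and satY: "\<And>y. y \<in> Y \<Longrightarrow> cell S V y \<subseteq> Y"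
  shows "sum (cell_dens E S V) (X \<times> Y) = card (E \<inter> X \<times> Y)"
proof -
  have fin: "finite (cell S V x)" for x
    using V cell_subset finite_subset by metis
  have count: "real (card (E \<inter> A \<times> B)) = (\<Sum>p\<in>A \<times> B. of_bool (p \<in> E))"
    if "finite A" "finite B" for A B
  proof -
    have "(\<Sum>p\<in>A \<times> B. of_bool (p \<in> E)) = real (card (A \<times> B \<inter> {p. p \<in> E}))"
      unfolding of_bool_def using that by (simp add: sum.If_cases)
    then show ?thesis
      by (simp add: Int_commute)
  qed
  have "sum (cell_dens E S V) (X \<times> Y) =
      (\<Sum>(A, B) \<in> cell S V ` X \<times> cell S V ` Y. sum (cell_dens E S V) (A \<times> B))"
    by (rule sum_cells[OF V X Y satX satY])
  also have "\<dots> = (\<Sum>(A, B) \<in> cell S V ` X \<times> cell S V ` Y. \<Sum>p\<in>A \<times> B. of_bool (p \<in> E))"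
  proof (rule sum.cong[OF refl], clarify)
    fix x y
    have "sum (cell_dens E S V) (cell S V x \<times> cell S V y) =
        (\<Sum>p\<in>cell S V x \<times> cell S V y. dens E (cell S V x) (cell S V y))"
      by (rule sum.cong[OF refl]) (rule cell_dens_const)
    also have "\<dots> = card (E \<inter> cell S V x \<times> cell S V y)"
      using dens_mult[OF fin fin, of E x y] by (simp add: card_cartesian_product mult_ac)
    also have "\<dots> = (\<Sum>p\<in>cell S V x \<times> cell S V y. of_bool (p \<in> E))"
      by (rule count[OF fin fin])
    finally show "sum (cell_dens E S V) (cell S V x \<times> cell S V y) =
        (\<Sum>p\<in>cell S V x \<times> cell S V y. of_bool (p \<in> E))" .
  qed
  also have "\<dots> = (\<Sum>p\<in>X \<times> Y. of_bool (p \<in> E))"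
    by (rule sum_cells[OF V X Y satX satY, symmetric])
  also have "\<dots> = card (E \<inter> X \<times> Y)"
    by (rule count[OF finite_subset[OF X V] finite_subset[OF Y V], symmetric])
  finally show ?thesis .
qed

text \<open>The squared L2 norm of that conditional expectation, left unnormalised: its upper bound
  is the square of \<open>card V\<close> rather than 1.\<close>

definition energy :: "('a \<times> 'a) set \<Rightarrow> 'a set set \<Rightarrow> 'a set \<Rightarrow> real" where
  "energy E S V = (\<Sum>p\<in>V \<times> V. (cell_dens E S V p)\<^sup>2)"

lemma energy_le:
  assumes "finite V"
  shows "energy E S V \<le> (real (card V))\<^sup>2"
proof -
  have fin: "finite (cell S V x)" for x
    using assms cell_subset finite_subset by metis
  have "energy E S V \<le> (\<Sum>p\<in>V \<times> V. 1)"
    unfolding energy_def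
    by (rule sum_mono) (use dens_bounds[OF fin fin] in \<open>auto simp: cell_dens_def power_le_one\<close>)
  then show ?thesis
    by (simp add: card_cartesian_product power2_eq_square)
qed

text \<open>The variance identity; the assumption says that \<open>t\<close> is the mean of
  \<open>g\<close>.\<close>

lemma sum_square_shift:
  fixes g :: "'a \<Rightarrow> real" and t :: real
  assumes "finite I" "sum g I = t * card I"
  shows "(\<Sum>p\<in>I. (g p)\<^sup>2) = t\<^sup>2 * card I + (\<Sum>p\<in>I. (g p - t)\<^sup>2)"
proof -
  have "(\<Sum>p\<in>I. (g p - t)\<^sup>2) = (\<Sum>p\<in>I. (g p)\<^sup>2 - 2 * t * g p + t\<^sup>2)"
    by (rule sum.cong[OF refl]) (simp add: power2_diff)
  also have "\<dots> = (\<Sum>p\<in>I. (g p)\<^sup>2) - 2 * t * sum g I + t\<^sup>2 * card I"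
    by (simp add: sum.distrib sum_subtractf sum_distrib_left)
  finally show ?thesis
    using assms(2) by (simp add: power2_eq_square algebra_simps)
qed

text \<open>Since \<open>A\<close> and \<open>B\<close> are unions of cells,
  \<open>dens E A B\<close> is the mean of \<open>g\<close> on the block, and the sum of squares
  splits into the square of the mean and the variance. The second part bounds the variance from
  below by what the subblock \<open>A' \<times> B'\<close> contributes to it.\<close>

lemma energy_block:
  fixes E S V
  defines "g \<equiv> cell_dens E S V"
  assumes V: "finite V" and AB: "A \<subseteq> V" "B \<subseteq> V"
    and sat: "\<And>x. x \<in> A \<Longrightarrow> cell S V x \<subseteq> A" "\<And>x. x \<in> B \<Longrightarrow> cell S V x \<subseteq> B"
  shows "(\<Sum>p\<in>A \<times> B. (g p)\<^sup>2) \<ge> (dens E A B)\<^sup>2 * (card A * card B)"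
    and "\<lbrakk>A' \<subseteq> A; B' \<subseteq> B; \<And>x. x \<in> A' \<Longrightarrow> cell S V x \<subseteq> A'; \<And>x. x \<in> B' \<Longrightarrow> cell S V x \<subseteq> B'\<rbrakk> \<Longrightarrow>
      (\<Sum>p\<in>A \<times> B. (g p)\<^sup>2) \<ge> (dens E A B)\<^sup>2 * (card A * card B)
        + (dens E A' B' - dens E A B)\<^sup>2 * (card A' * card B')"
proof -
  define D where "D = dens E A B"
  have fin: "finite A" "finite B"
    using finite_subset[OF AB(1) V] finite_subset[OF AB(2) V] by simp_all
  have "sum g (A \<times> B) = D * card (A \<times> B)"
    unfolding g_def D_def
    by (subst sum_cell_dens) (use V AB sat dens_mult[OF fin, of E] in \<open>auto simp: card_cartesian_product\<close>)
  then have eq: "(\<Sum>p\<in>A \<times> B. (g p)\<^sup>2) = D\<^sup>2 * card (A \<times> B) + (\<Sum>p\<in>A \<times> B. (g p - D)\<^sup>2)"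
    using fin by (intro sum_square_shift) auto
  then show "(\<Sum>p\<in>A \<times> B. (g p)\<^sup>2) \<ge> (dens E A B)\<^sup>2 * (card A * card B)"
    by (simp add: D_def card_cartesian_product sum_nonneg)
  assume AB': "A' \<subseteq> A" "B' \<subseteq> B"
    and sat': "\<And>x. x \<in> A' \<Longrightarrow> cell S V x \<subseteq> A'" "\<And>x. x \<in> B' \<Longrightarrow> cell S V x \<subseteq> B'"
  have fin': "finite A'" "finite B'"
    using finite_subset[OF AB'(1) fin(1)] finite_subset[OF AB'(2) fin(2)] by simp_all
  define t where "t = dens E A' B' - D"
  have "sum g (A' \<times> B') = card (E \<inter> A' \<times> B')"
    unfolding g_def using V AB AB' sat' by (intro sum_cell_dens) auto
  then have "(\<Sum>p\<in>A' \<times> B'. g p - D) = t * card (A' \<times> B')"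
    using dens_mult[OF fin', of E]
    by (simp add: sum_subtractf t_def card_cartesian_product algebra_simps)
  \<comment> \<open>The variance identity again, now for \<open>g - D\<close>, whose mean on the
    subblock is \<open>t\<close>.\<close>
  then have "(\<Sum>p\<in>A' \<times> B'. (g p - D)\<^sup>2) \<ge> t\<^sup>2 * card (A' \<times> B')"
    using sum_square_shift[of "A' \<times> B'" "\<lambda>p. g p - D" t] fin' by (simp add: sum_nonneg)
  also have "(\<Sum>p\<in>A' \<times> B'. (g p - D)\<^sup>2) \<le> (\<Sum>p\<in>A \<times> B. (g p - D)\<^sup>2)"
    by (rule sum_mono2) (use fin AB' in auto)
  finally show "(\<Sum>p\<in>A \<times> B. (g p)\<^sup>2) \<ge> (dens E A B)\<^sup>2 * (card A * card B)
        + (dens E A' B' - dens E A B)\<^sup>2 * (card A' * card B')"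
    using eq by (simp add: D_def t_def card_cartesian_product)
qed

text \<open>Irregularity is counted in pairs of points, which weights each pair of cells by the
  product of its sizes, as suits cells of unequal size.\<close>

definition irregular_points :: "real \<Rightarrow> ('a \<times> 'a) set \<Rightarrow> 'a set set \<Rightarrow> 'a set \<Rightarrow> ('a \<times> 'a) set" where
  "irregular_points \<epsilon> E S V =
     {(x, y) \<in> V \<times> V. \<not> regular_pair \<epsilon> E (cell S V x) (cell S V y)}"

text \<open>The new family adds the witnessing subsets of every irregular pair of cells, at most two
  sets for each of the \<open>2 ^ card S * 2 ^ card S\<close> pairs. On an irregular pair the
  deviation exceeds \<epsilon> on a subblock with sides at least \<epsilon> times those of the
  block, which gains \<epsilon>^4 per pair of points; regular pairs lose nothing. More than
  \<epsilon> (card V)^2 irregular pairs of points thus gain \<epsilon>^5 (card V)^2.\<close>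

lemma energy_increment:
  fixes \<epsilon> :: real
  assumes V: "finite V" and S: "finite S" and e: "\<epsilon> > 0"
    and irr: "card (irregular_points \<epsilon> E S V) > \<epsilon> * (card V)\<^sup>2"
  obtains S' where "finite S'" "card S' \<le> card S + 2 * (2 ^ card S * 2 ^ card S)"
    "energy E S' V \<ge> energy E S V + \<epsilon> ^ 5 * (card V)\<^sup>2"
proof -
  define C where "C = cell S V ` V"
  define wit where "wit = (\<lambda>(A, B) (A', B'). A' \<subseteq> A \<and> B' \<subseteq> B \<and> real (card A') \<ge> \<epsilon> * real (card A) \<and>
    real (card B') \<ge> \<epsilon> * real (card B) \<and> \<bar>dens E A' B' - dens E A B\<bar> > \<epsilon>)"
  \<comment> \<open>At a regular pair the choice is arbitrary; its two sets only refine the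
    partition, which cannot lower the energy of a block.\<close>
  define w where "w c = (SOME c'. wit c c')" for c
  define S' where "S' = S \<union> (fst \<circ> w) ` (C \<times> C) \<union> (snd \<circ> w) ` (C \<times> C)"
  have finC: "finite C" and cardC: "card C \<le> 2 ^ card S"
    using card_cells_le[OF S] by (auto simp: C_def)
  have finS': "finite S'"
    using S finC by (auto simp: S'_def)
  have "card S' \<le> card S + card ((fst \<circ> w) ` (C \<times> C)) + card ((snd \<circ> w) ` (C \<times> C))"
    unfolding S'_def by (meson card_Un_le order_trans add_le_mono1)
  also have "\<dots> \<le> card S + card (C \<times> C) + card (C \<times> C)"
    using finC by (intro add_mono card_image_le) auto
  also have "\<dots> \<le> card S + 2 * (2 ^ card S * 2 ^ card S)"
    using mult_mono[OF cardC cardC] by (simp add: card_cartesian_product)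
  finally have cardS': "card S' \<le> card S + 2 * (2 ^ card S * 2 ^ card S)" .
  have finA: "finite A" "A \<subseteq> V" if "A \<in> C" for A
    using that V cell_subset[of S V] finite_subset unfolding C_def by blast+
  have satC: "cell S' V x \<subseteq> A" if "A \<in> C" "x \<in> A" for A x
    using that cell_antimono[of S S' V x] cell_eqI[of x S V] unfolding C_def S'_def by blast
  let ?irr = "\<lambda>(A, B). of_bool (\<not> regular_pair \<epsilon> E A B) :: real"
  have block: "(\<Sum>p\<in>A \<times> B. (cell_dens E S' V p)\<^sup>2) \<ge>
      (\<Sum>p\<in>A \<times> B. (cell_dens E S V p)\<^sup>2 + \<epsilon> ^ 4 * of_bool (p \<in> irregular_points \<epsilon> E S V))"
    if AB: "A \<in> C" "B \<in> C" for A B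
  proof -
    obtain x y where xy: "A = cell S V x" "B = cell S V y"
      using AB by (auto simp: C_def)
    have pt: "cell_dens E S V p = dens E A B \<and> (p \<in> irregular_points \<epsilon> E S V \<longleftrightarrow> \<not> regular_pair \<epsilon> E A B)"
      if "p \<in> A \<times> B" for p
      using that cell_dens_const[of p S V x y E] finA AB cell_eqI[of _ S V] unfolding xy irregular_points_def
      by fastforce
    have rhs: "(\<Sum>p\<in>A \<times> B. (cell_dens E S V p)\<^sup>2 + \<epsilon> ^ 4 * of_bool (p \<in> irregular_points \<epsilon> E S V)) =
        (\<Sum>p\<in>A \<times> B. (dens E A B)\<^sup>2 + \<epsilon> ^ 4 * ?irr (A, B))"
      by (rule sum.cong) (use pt in auto)
    show ?thesis
    proof (cases "regular_pair \<epsilon> E A B")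
      case True
      have "(\<Sum>p\<in>A \<times> B. (cell_dens E S' V p)\<^sup>2) \<ge> (dens E A B)\<^sup>2 * (card A * card B)"
        by (rule energy_block(1)) (use V finA AB satC in blast)+
      then show ?thesis
        unfolding rhs using True by (simp add: card_cartesian_product mult_ac)
    next
      case False
      then have "\<exists>A' B'. wit (A, B) (A', B')"
        unfolding regular_pair_def wit_def by (auto simp: not_le)
      then have "wit (A, B) (w (A, B))"
        unfolding w_def by (metis someI)
      moreover obtain A' B' where w: "w (A, B) = (A', B')"
        by fastforce
      ultimately have wit: "A' \<subseteq> A" "B' \<subseteq> B" "real (card A') \<ge> \<epsilon> * real (card A)"
        "real (card B') \<ge> \<epsilon> * real (card B)" "\<bar>dens E A' B' - dens E A B\<bar> > \<epsilon>"
        by (simp_all add: wit_def)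
      have wS: "fst (w (A, B)) \<in> S'" "snd (w (A, B)) \<in> S'"
        using AB unfolding S'_def by (auto intro!: imageI simp del: fst_conv snd_conv)
      have "(\<Sum>p\<in>A \<times> B. (cell_dens E S' V p)\<^sup>2) \<ge> (dens E A B)\<^sup>2 * (card A * card B)
          + (dens E A' B' - dens E A B)\<^sup>2 * (card A' * card B')"
      proof (rule energy_block(2))
        show "cell S' V x \<subseteq> A'" if "x \<in> A'" for x
          using wS(1) that by (intro cell_subset_member) (simp_all add: w)
        show "cell S' V x \<subseteq> B'" if "x \<in> B'" for x
          using wS(2) that by (intro cell_subset_member) (simp_all add: w)
      qed (use V finA AB satC wit(1,2) in blast)+
      moreover have "(dens E A' B' - dens E A B)\<^sup>2 * (card A' * card B') \<ge>
          \<epsilon>\<^sup>2 * ((\<epsilon> * card A) * (\<epsilon> * card B))"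
      proof (rule mult_mono)
        show "(dens E A' B' - dens E A B)\<^sup>2 \<ge> \<epsilon>\<^sup>2"
          using wit(5) e by (metis abs_le_square_iff abs_of_pos less_imp_le)
        show "\<epsilon> * card A * (\<epsilon> * card B) \<le> real (card A' * card B')"
          using mult_mono[OF wit(3,4)] e by simp
      qed (use e in simp_all)
      ultimately show ?thesis
        unfolding rhs using False
        by (simp add: card_cartesian_product algebra_simps power4_eq_xxxx power2_eq_square)
    qed
  qed
  have "energy E S V + \<epsilon> ^ 4 * card (irregular_points \<epsilon> E S V) =
      (\<Sum>p\<in>V \<times> V. (cell_dens E S V p)\<^sup>2 + \<epsilon> ^ 4 * of_bool (p \<in> irregular_points \<epsilon> E S V))"
  proof -
    have "V \<times> V \<inter> irregular_points \<epsilon> E S V = irregular_points \<epsilon> E S V"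
      by (auto simp: irregular_points_def)
    then have "(\<Sum>p\<in>V \<times> V. of_bool (p \<in> irregular_points \<epsilon> E S V)) = real (card (irregular_points \<epsilon> E S V))"
      using V unfolding of_bool_def by (simp add: sum.If_cases)
    then show ?thesis
      by (simp add: energy_def sum.distrib flip: sum_distrib_left)
  qed
  also have "\<dots> = (\<Sum>(A, B)\<in>C \<times> C. \<Sum>p\<in>A \<times> B.
      (cell_dens E S V p)\<^sup>2 + \<epsilon> ^ 4 * of_bool (p \<in> irregular_points \<epsilon> E S V))"
    unfolding C_def by (rule sum_cells) (rule V subset_refl cell_subset)+
  also have "\<dots> \<le> (\<Sum>(A, B)\<in>C \<times> C. \<Sum>p\<in>A \<times> B. (cell_dens E S' V p)\<^sup>2)"
    by (rule sum_mono) (use block in auto)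
  also have "\<dots> = energy E S' V"
    unfolding C_def energy_def by (rule sum_cells[symmetric]) (rule V subset_refl cell_subset)+
  finally have "energy E S' V \<ge> energy E S V + \<epsilon> ^ 4 * card (irregular_points \<epsilon> E S V)" .
  moreover have "\<epsilon> ^ 4 * card (irregular_points \<epsilon> E S V) \<ge> \<epsilon> ^ 4 * (\<epsilon> * (card V)\<^sup>2)"
    using irr e by (intro mult_left_mono) auto
  ultimately have "energy E S' V \<ge> energy E S V + \<epsilon> ^ 5 * (card V)\<^sup>2"
    by (simp add: power_Suc2[of \<epsilon> 4, simplified] mult_ac)
  then show thesis
    using that finS' cardS' by blast
qed

theorem regularity:
  fixes \<epsilon> :: real
  assumes e: "\<epsilon> > 0"
  obtains M :: nat where "\<And>(V :: 'a set) E. finite V \<Longrightarrow>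
    \<exists>S. finite S \<and> card S \<le> M \<and> card (irregular_points \<epsilon> E S V) \<le> \<epsilon> * (card V)\<^sup>2"
proof -
  \<comment> \<open>The size of the family after each round of refinement, following the bound in
    \<open>energy_increment\<close>; it grows like a tower.\<close>
  define N :: "nat \<Rightarrow> nat" where "N = rec_nat 0 (\<lambda>_ m. m + 2 * (2 ^ m * 2 ^ m))"
  have N: "N 0 = 0" "N (Suc k) = N k + 2 * (2 ^ N k * 2 ^ N k)" for k
    by (simp_all add: N_def)
  \<comment> \<open>The energy is at most (card V)^2, so \<open>K\<close> rounds that gain
    \<epsilon>^5 (card V)^2 each are impossible.\<close>
  obtain K :: nat where K: "real K * \<epsilon> ^ 5 > 1"
    using e reals_Archimedean3[of "\<epsilon> ^ 5"] by auto
  have "\<exists>S. finite S \<and> card S \<le> N K \<and> card (irregular_points \<epsilon> E S V) \<le> \<epsilon> * (card V)\<^sup>2"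
    if V: "finite V" for V :: "'a set" and E
  proof (cases "V = {}")
    case True
    then show ?thesis
      by (intro exI[of _ "{}"]) (simp add: irregular_points_def)
  next
    case False
    \<comment> \<open>Either a regular family has appeared by round \<open>k\<close>, or all
      \<open>k\<close> rounds have paid their energy increment. At \<open>k = K\<close> only the
      former survives.\<close>
    have "(\<exists>S. finite S \<and> card S \<le> N k \<and> card (irregular_points \<epsilon> E S V) \<le> \<epsilon> * (card V)\<^sup>2) \<or>
        (\<exists>S. finite S \<and> card S \<le> N k \<and> energy E S V \<ge> k * (\<epsilon> ^ 5 * (card V)\<^sup>2))" for k
    proof (induction k)
      case 0
      have "energy E {} V \<ge> 0"
        by (simp add: energy_def sum_nonneg)
      then show ?case
        by (intro disjI2 exI[of _ "{}"]) auto
    next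
      case (Suc k)
      then consider S where "finite S" "card S \<le> N k" "card (irregular_points \<epsilon> E S V) \<le> \<epsilon> * (card V)\<^sup>2"
        | S where "finite S" "card S \<le> N k" "card (irregular_points \<epsilon> E S V) > \<epsilon> * (card V)\<^sup>2"
          "energy E S V \<ge> k * (\<epsilon> ^ 5 * (card V)\<^sup>2)"
        by (meson not_le)
      then show ?case
      proof cases
        case (1 S)
        then show ?thesis
          unfolding N by (meson trans_le_add1)
      next
        case (2 S)
        obtain S' where S': "finite S'" "card S' \<le> card S + 2 * (2 ^ card S * 2 ^ card S)"
          "energy E S' V \<ge> energy E S V + \<epsilon> ^ 5 * (card V)\<^sup>2"
          using energy_increment[OF V 2(1) e 2(3)] by metis
        have "(2::nat) ^ card S \<le> 2 ^ N k"
          using 2(2) by simp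
        then have "card S' \<le> N (Suc k)"
          using S'(2) 2(2) mult_mono[of "(2::nat) ^ card S" "2 ^ N k" "2 ^ card S" "2 ^ N k"]
          unfolding N by linarith
        moreover have "energy E S' V \<ge> real (Suc k) * (\<epsilon> ^ 5 * (card V)\<^sup>2)"
          using S'(3) 2(4) by (simp add: algebra_simps)
        ultimately show ?thesis
          using S'(1) by blast
      qed
    qed
    moreover have "energy E S V < K * (\<epsilon> ^ 5 * (card V)\<^sup>2)" for S
    proof -
      have "energy E S V \<le> 1 * (real (card V))\<^sup>2"
        using energy_le[OF V] by simp
      also have "\<dots> < (K * \<epsilon> ^ 5) * (real (card V))\<^sup>2"
        using K False V by (intro mult_strict_right_mono) (auto simp: card_gt_0_iff)
      finally show ?thesis
        by (simp add: mult_ac)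
    qed
    ultimately show ?thesis
      by (meson not_le)
  qed
  then show thesis
    using that by blast
qed


section \<open>Cleaning: few edges lie in irregular, sparse or small pairs of cells\<close>

text \<open>A block of density below \<open>d\<close> holds at most \<open>d\<close> times its size
  in pairs of \<open>E\<close>, and the sizes of all blocks add up to (card V)^2.\<close>

lemma low_density_pairs_few:
  fixes d :: real
  assumes V: "finite V" and d: "d \<ge> 0"
  shows "card {p \<in> E \<inter> V \<times> V. cell_dens E S V p < d} \<le> d * (card V)\<^sup>2"
proof -
  define C where "C = cell S V ` V"
  let ?h = "\<lambda>p. of_bool (p \<in> E \<and> cell_dens E S V p < d) :: real"
  have fin: "finite (cell S V x)" for x
    using V cell_subset finite_subset by metis
  have "real (card {p \<in> E \<inter> V \<times> V. cell_dens E S V p < d}) = sum ?h (V \<times> V)"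
  proof -
    have "V \<times> V \<inter> {p. p \<in> E \<and> cell_dens E S V p < d} = {p \<in> E \<inter> V \<times> V. cell_dens E S V p < d}"
      by auto
    then show ?thesis
      using V unfolding of_bool_def by (simp add: sum.If_cases)
  qed
  also have "\<dots> = (\<Sum>(A, B)\<in>C \<times> C. sum ?h (A \<times> B))"
    unfolding C_def by (rule sum_cells) (rule V subset_refl cell_subset)+
  also have "\<dots> \<le> (\<Sum>(A, B)\<in>C \<times> C. \<Sum>p\<in>A \<times> B. d)"
  proof (rule sum_mono, clarify)
    fix A B assume "A \<in> C" "B \<in> C"
    then obtain x y where xy: "A = cell S V x" "B = cell S V y"
      by (auto simp: C_def)
    have cd: "cell_dens E S V p = dens E A B" if "p \<in> A \<times> B" for p
      using that cell_dens_const xy by metis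
    show "sum ?h (A \<times> B) \<le> (\<Sum>p\<in>A \<times> B. d)"
    proof (cases "dens E A B < d")
      case True
      have "sum ?h (A \<times> B) = (\<Sum>p\<in>A \<times> B. of_bool (p \<in> E))"
        by (rule sum.cong[OF refl]) (use cd True in simp)
      also have "\<dots> = real (card (E \<inter> A \<times> B))"
        using fin xy unfolding of_bool_def by (simp add: sum.If_cases Int_commute)
      also have "\<dots> = dens E A B * (card A * card B)"
        using dens_mult fin xy by metis
      also have "\<dots> \<le> d * (card A * card B)"
        using True by (intro mult_right_mono) auto
      finally show ?thesis
        by (simp add: card_cartesian_product mult_ac)
    next
      case False
      then have "sum ?h (A \<times> B) = (\<Sum>p\<in>A \<times> B. 0)"
        by (intro sum.cong[OF refl]) (use cd in auto)
      then show ?thesis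
        using d by (simp add: sum_nonneg)
    qed
  qed
  also have "\<dots> = (\<Sum>p\<in>V \<times> V. d)"
    unfolding C_def by (rule sum_cells[symmetric]) (rule V subset_refl cell_subset)+
  finally show ?thesis
    by (simp add: card_cartesian_product power2_eq_square mult_ac)
qed

text \<open>There are at most \<open>2 ^ card S\<close> cells, and each small one has fewer than
  \<open>t\<close> points.\<close>

lemma points_in_small_cells_few:
  fixes t :: real
  assumes V: "finite V" and S: "finite S" and t: "t \<ge> 0"
  shows "card {x \<in> V. card (cell S V x) < t} \<le> 2 ^ card S * t"
proof -
  define D where "D = {A \<in> cell S V ` V. card A < t}"
  have finD: "finite D"
    using card_cells_le[OF S, of V V] by (simp add: D_def)
  have "card D \<le> card (cell S V ` V)"
    unfolding D_def using card_cells_le(1)[OF S] by (intro card_mono) auto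
  then have cardD: "card D \<le> 2 ^ card S"
    using card_cells_le(2)[OF S, of V V] by linarith
  have "{x \<in> V. card (cell S V x) < t} \<subseteq> \<Union> D"
    using self_in_cell unfolding D_def by fastforce
  moreover have "finite (\<Union> D)"
    by (rule finite_subset[OF _ V]) (use cell_subset in \<open>fastforce simp: D_def\<close>)
  ultimately have "card {x \<in> V. card (cell S V x) < t} \<le> card (\<Union> D)"
    by (intro card_mono)
  also have "\<dots> \<le> sum card D"
    by (rule card_Union_le_sum_card)
  finally have "real (card {x \<in> V. card (cell S V x) < t}) \<le> (\<Sum>A\<in>D. real (card A))"
    by (simp flip: of_nat_sum)
  also have "\<dots> \<le> (\<Sum>A\<in>D. t)"
    by (rule sum_mono) (auto simp: D_def)
  also have "\<dots> \<le> 2 ^ card S * t"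
  proof -
    have "real (card D) \<le> 2 ^ card S"
      using cardD by (metis of_nat_le_iff of_nat_numeral of_nat_power)
    then show ?thesis
      using t by (simp add: mult_right_mono)
  qed
  finally show ?thesis .
qed

definition clean_pair ::
    "real \<Rightarrow> real \<Rightarrow> real \<Rightarrow> ('a \<times> 'a) set \<Rightarrow> 'a set \<Rightarrow> 'a set \<Rightarrow> bool" where
  "clean_pair \<epsilon> d t E A B \<longleftrightarrow>
     regular_pair \<epsilon> E A B \<and> dens E A B \<ge> d \<and> real (card A) \<ge> t \<and> real (card B) \<ge> t"

text \<open>The error splits by the reason why a pair of \<open>E\<close> fails to be clean:
  \<epsilon> for irregular cells, \<open>d\<close> for low density, and \<gamma> for each of the two
  coordinates lying in a small cell. The constant \<open>c\<close> is fixed before \<open>V\<close>,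
  so clean cells have linear size.\<close>

lemma regular_partition_cleaning:
  fixes \<epsilon> d \<gamma> :: real
  assumes pos: "\<epsilon> > 0" "d \<ge> 0" "\<gamma> > 0"
  obtains c :: real where "c > 0" and "\<And>(V :: 'a set) E. finite V \<Longrightarrow>
    \<exists>P. (\<forall>x. P x \<subseteq> V) \<and>
      card {(x, y) \<in> E \<inter> V \<times> V. \<not> clean_pair \<epsilon> d (c * card V) E (P x) (P y)}
        \<le> (\<epsilon> + d + 2 * \<gamma>) * (card V)\<^sup>2"
proof -
  obtain M :: nat where M: "\<And>(V :: 'a set) E. finite V \<Longrightarrow>
      \<exists>S. finite S \<and> card S \<le> M \<and> card (irregular_points \<epsilon> E S V) \<le> \<epsilon> * (card V)\<^sup>2"
    using regularity[OF pos(1), where ?'a = 'a] by metis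
  \<comment> \<open>With at most \<open>2 ^ M\<close> cells, those below \<open>c * card V\<close>
    cover at most \<open>\<gamma> * card V\<close> points.\<close>
  define c where "c = \<gamma> / 2 ^ M"
  have "\<exists>P. (\<forall>x. P x \<subseteq> V) \<and>
      card {(x, y) \<in> E \<inter> V \<times> V. \<not> clean_pair \<epsilon> d (c * card V) E (P x) (P y)}
        \<le> (\<epsilon> + d + 2 * \<gamma>) * (card V)\<^sup>2"
    if V: "finite V" for V :: "'a set" and E
  proof -
    obtain S where S: "finite S" "card S \<le> M"
      and irr: "card (irregular_points \<epsilon> E S V) \<le> \<epsilon> * (card V)\<^sup>2"
      using M[OF V] by metis
    define Q where "Q = {x \<in> V. card (cell S V x) < c * card V}"
    let ?L = "{p \<in> E \<inter> V \<times> V. cell_dens E S V p < d}"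
    let ?B = "{(x, y) \<in> E \<inter> V \<times> V.
      \<not> clean_pair \<epsilon> d (c * card V) E (cell S V x) (cell S V y)}"
    have "real (card Q) \<le> 2 ^ card S * (c * card V)"
      unfolding Q_def using V S pos by (intro points_in_small_cells_few) (auto simp: c_def)
    also have "\<dots> \<le> 2 ^ M * (c * card V)"
      using S pos by (intro mult_right_mono power_increasing) (auto simp: c_def)
    finally have Q: "real (card Q) \<le> \<gamma> * card V"
      by (simp add: c_def)
    then have QV: "real (card Q) * card V \<le> \<gamma> * (card V)\<^sup>2"
      using mult_right_mono[OF Q, of "real (card V)"] by (simp add: power2_eq_square mult_ac)
    have "finite Q"
      using V by (simp add: Q_def)
    have "?B \<subseteq> irregular_points \<epsilon> E S V \<union> ?L \<union> Q \<times> V \<union> V \<times> Q"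
      by (auto simp: clean_pair_def irregular_points_def cell_dens_def Q_def not_le)
    then have "card ?B \<le> card (irregular_points \<epsilon> E S V \<union> ?L \<union> Q \<times> V \<union> V \<times> Q)"
      using V \<open>finite Q\<close>
      by (intro card_mono) (auto intro: finite_subset[of _ "V \<times> V"] simp: irregular_points_def)
    also have "\<dots> \<le> card (irregular_points \<epsilon> E S V) + card ?L + card (Q \<times> V) + card (V \<times> Q)"
      by (meson card_Un_le order_trans add_le_mono1)
    finally have "real (card ?B) \<le> real (card (irregular_points \<epsilon> E S V)) + real (card ?L)
        + real (card Q) * card V + real (card Q) * card V"
      by (simp add: card_cartesian_product mult.commute flip: of_nat_mult of_nat_add)
    also have "\<dots> \<le> \<epsilon> * (card V)\<^sup>2 + d * (card V)\<^sup>2 + \<gamma> * (card V)\<^sup>2 + \<gamma> * (card V)\<^sup>2"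
      using irr low_density_pairs_few[OF V pos(2)] QV by (intro add_mono) auto
    finally show ?thesis
      by (intro exI[of _ "cell S V"]) (simp add: cell_subset algebra_simps)
  qed
  moreover have "c > 0"
    using pos by (simp add: c_def)
  ultimately show thesis
    using that by blast
qed

section \<open>Greedy embedding into regular pairs\<close>

text \<open>Were the exceptional set \<open>L\<close> larger than the bound, regularity would apply
  to \<open>L\<close> and \<open>D\<close> and force density at least \<open>q\<close> between them;
  this is what the slack \<delta> in the density hypothesis is for. But the low degrees make that
  density less than \<open>q\<close>.\<close>

lemma few_low_degree:
  fixes \<delta> q :: real
  assumes reg: "regular_pair \<delta> E A B" and dens: "dens E A B \<ge> q + \<delta>" and pos: "\<delta> > 0"
    and fin: "finite A" "finite B" and ne: "A \<noteq> {}" "B \<noteq> {}"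
    and C: "C \<subseteq> A" and D: "D \<subseteq> B" "real (card D) \<ge> \<delta> * card B"
  shows "card {x \<in> C. card {y \<in> D. (x, y) \<in> E} < q * card D} \<le> \<delta> * card A"
proof (rule ccontr)
  define L where "L = {x \<in> C. card {y \<in> D. (x, y) \<in> E} < q * card D}"
  assume "\<not> ?thesis"
  then have big: "real (card L) > \<delta> * card A"
    by (simp add: L_def)
  have LA: "L \<subseteq> A"
    using C by (auto simp: L_def)
  have finL: "finite L" "finite D"
    using finite_subset[OF LA fin(1)] finite_subset[OF D(1) fin(2)] by simp_all
  have "real (card L) > 0"
    using big pos by (meson le_less_trans of_nat_0_le_iff zero_le_mult_iff less_imp_le)
  then have neL: "L \<noteq> {}"
    by auto
  have "E \<inter> L \<times> D = (SIGMA x:L. {y \<in> D. (x, y) \<in> E})"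
    by auto
  then have "real (card (E \<inter> L \<times> D)) = (\<Sum>x\<in>L. real (card {y \<in> D. (x, y) \<in> E}))"
    using finL by simp
  also have "\<dots> < (\<Sum>x\<in>L. q * card D)"
    by (rule sum_strict_mono[OF finL(1) neL]) (auto simp: L_def)
  also have "\<dots> = q * (card L * card D)"
    by simp
  finally have "dens E L D * (card L * card D) < q * (card L * card D)"
    using dens_mult[OF finL, of E] by simp
  then have "dens E L D < q"
    by (metis mult_less_cancel_right of_nat_0_le_iff not_le)
  moreover have "\<bar>dens E L D - dens E A B\<bar> \<le> \<delta>"
    using reg LA D big unfolding regular_pair_def by force
  ultimately show False
    using dens by linarith
qed

text \<open>The predicate \<open>good\<close> collects further requirements on the partial embeddings; each
  greedy step may lose a \<open>\<beta>\<close>-fraction of all vertices to them.\<close>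

lemma regular_embedding:
  fixes P :: "'b \<Rightarrow> 'a set" and q \<delta> \<beta> c :: real
  assumes W: "finite W" and V: "finite V" "V \<noteq> {}"
    and adj: "\<And>u w. adj u w \<Longrightarrow> adj w u" "\<And>u. \<not> adj u u"
    and E: "sym E"
    and P: "\<And>w. w \<in> W \<Longrightarrow> P w \<subseteq> V"
    and clean: "\<And>u w. u \<in> W \<Longrightarrow> w \<in> W \<Longrightarrow> adj u w \<Longrightarrow> clean_pair \<delta> (q + \<delta>) (c * card V) E (P u) (P w)"
    and nbr: "\<And>w. w \<in> W \<Longrightarrow> \<exists>u\<in>W. adj u w"
    and pos: "0 < q" "q \<le> 1" "0 < c" "0 < \<delta>" "0 \<le> \<beta>"
    and \<delta>: "\<delta> \<le> q ^ card W" "card W * \<delta> + \<beta> / c < q ^ card W"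
    and good_empty: "\<And>\<phi>. good {} \<phi>"
    and good_step: "\<And>U w \<phi>. U \<subseteq> W \<Longrightarrow> w \<in> W - U \<Longrightarrow> \<phi> ` U \<subseteq> V \<Longrightarrow> good U \<phi> \<Longrightarrow>
      card {x \<in> V. \<not> good (insert w U) (\<phi>(w := x))} \<le> \<beta> * card V"
  obtains \<phi> where "\<And>u w. u \<in> W \<Longrightarrow> w \<in> W \<Longrightarrow> adj u w \<Longrightarrow> (\<phi> u, \<phi> w) \<in> E" "good W \<phi>"
proof -
  \<comment> \<open>The vertices still open for \<open>w\<close>: those of its cell that are joined
    to the images of all its neighbours in \<open>U\<close>.\<close>
  define cand where "cand U \<phi> w = {x \<in> P w. \<forall>u\<in>U. adj u w \<longrightarrow> (\<phi> u, x) \<in> E}" for U \<phi> w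
  have finP: "finite (P w)" if "w \<in> W" for w
    using finite_subset[OF P[OF that] V(1)] .
  have n0: "real (card V) > 0"
    using V by (simp add: card_gt_0_iff)
  \<comment> \<open>The size bound is part of \<open>clean_pair\<close>, so it is read off from a
    neighbour of \<open>w\<close>.\<close>
  have cardP: "real (card (P w)) \<ge> c * card V" if "w \<in> W" for w
    using nbr[OF that] clean that by (auto simp: clean_pair_def)
  then have P0: "real (card (P w)) > 0" if "w \<in> W" for w
    using that n0 pos by (meson less_le_trans mult_pos_pos)
  then have neP: "P w \<noteq> {}" if "w \<in> W" for w
    using that by fastforce
  \<comment> \<open>Invariant: each embedded vertex costs the candidate sets of the remaining ones
    at most a factor \<open>q\<close>.\<close>
  have "\<exists>\<phi>. good U \<phi> \<and> (\<forall>u\<in>U. \<phi> u \<in> P u) \<and> (\<forall>u\<in>U. \<forall>w\<in>U. adj u w \<longrightarrow> (\<phi> u, \<phi> w) \<in> E) \<and>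
      (\<forall>w\<in>W - U. real (card (cand U \<phi> w)) \<ge> q ^ card U * card (P w))"
    if "finite U" "U \<subseteq> W" for U
    using that
  proof (induction U rule: finite_induct)
    case empty
    then show ?case
      by (auto simp: good_empty cand_def)
  next
    case (insert w U)
    then obtain \<phi> where good: "good U \<phi>" and \<phi>P: "\<And>u. u \<in> U \<Longrightarrow> \<phi> u \<in> P u"
      and \<phi>E: "\<And>u w. u \<in> U \<Longrightarrow> w \<in> U \<Longrightarrow> adj u w \<Longrightarrow> (\<phi> u, \<phi> w) \<in> E"
      and cand: "\<And>w. w \<in> W - U \<Longrightarrow> real (card (cand U \<phi> w)) \<ge> q ^ card U * card (P w)"
      by auto
    have w: "w \<in> W - U" "w \<in> W" "U \<subseteq> W"
      using insert by auto
    have "card U \<le> card W"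
      using W w(3) by (rule card_mono)
    then have qU: "q ^ card W \<le> q ^ card U"
      using pos by (intro power_decreasing) auto
    \<comment> \<open>\<open>R\<close> consists of the neighbours of \<open>w\<close> still to be
      embedded. \<open>L v\<close> collects the choices for \<open>w\<close> that would shrink the
      candidates of \<open>v\<close> by more than the factor \<open>q\<close>, and \<open>X\<close>
      those that violate \<open>good\<close>.\<close>
    define R where "R = {v \<in> W - insert w U. adj w v}"
    define L where "L v = {x \<in> cand U \<phi> w. card {y \<in> cand U \<phi> v. (x, y) \<in> E} < q * card (cand U \<phi> v)}" for v
    define X where "X = {x \<in> V. \<not> good (insert w U) (\<phi>(w := x))}"
    have L: "card (L v) \<le> \<delta> * card (P w)" if v: "v \<in> R" for v
      unfolding L_def
    proof (rule few_low_degree[where B = "P v"])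
      have vW: "v \<in> W" "v \<in> W - U" "adj w v"
        using v by (auto simp: R_def)
      show "regular_pair \<delta> E (P w) (P v)" "q + \<delta> \<le> dens E (P w) (P v)"
        using clean[of w v] vW w by (auto simp: clean_pair_def)
      show "finite (P w)" "finite (P v)" "P w \<noteq> {}" "P v \<noteq> {}"
        using finP neP vW w by auto
      \<comment> \<open>Candidate sets keep at least the fraction \<open>q ^ card W\<close>, hence
        at least \<delta>, of their cell, so regularity applies to them.\<close>
      show "\<delta> * card (P v) \<le> card (cand U \<phi> v)"
        using cand[OF vW(2)] \<delta>(1) qU mult_right_mono[of \<delta> "q ^ card U" "real (card (P v))"] by simp
    qed (use pos in \<open>auto simp: cand_def\<close>)
    have finR: "finite R" and cardR: "card R \<le> card W"
      using W unfolding R_def by (auto intro: card_mono)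
    have finL: "finite (L v)" for v
      using finP w by (simp add: L_def cand_def)
    have "card (X \<union> (\<Union>v\<in>R. L v)) \<le> card X + (\<Sum>v\<in>R. card (L v))"
      using card_UN_le[OF finR, of L] card_Un_le[of X "\<Union>v\<in>R. L v"] by linarith
    then have "real (card (X \<union> (\<Union>v\<in>R. L v))) \<le> card X + (\<Sum>v\<in>R. real (card (L v)))"
      by (simp flip: of_nat_sum of_nat_add)
    also have "\<dots> \<le> \<beta> * card V + (\<Sum>v\<in>R. \<delta> * card (P w))"
    proof (rule add_mono)
      have "\<phi> ` U \<subseteq> V"
        using \<phi>P P w(3) by blast
      then show "card X \<le> \<beta> * card V"
        unfolding X_def using good_step[OF w(3,1) _ good] by simp
    qed (rule sum_mono, rule L)
    also have "\<dots> \<le> \<beta> / c * card (P w) + card W * \<delta> * card (P w)"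
    proof (rule add_mono)
      have "\<beta> / c * (c * card V) \<le> \<beta> / c * card (P w)"
        using cardP[OF w(2)] pos by (intro mult_left_mono) auto
      then show "\<beta> * card V \<le> \<beta> / c * card (P w)"
        using pos by simp
      have "real (card R) * (\<delta> * card (P w)) \<le> real (card W) * (\<delta> * card (P w))"
        using cardR pos by (intro mult_right_mono) auto
      then show "(\<Sum>v\<in>R. \<delta> * card (P w)) \<le> card W * \<delta> * card (P w)"
        by (simp add: mult_ac)
    qed
    also have "\<dots> = (card W * \<delta> + \<beta> / c) * card (P w)"
      by (simp add: algebra_simps)
    also have "\<dots> < q ^ card W * card (P w)"
      using \<delta>(2) P0[OF w(2)] by (rule mult_strict_right_mono)
    also have "\<dots> \<le> q ^ card U * card (P w)"
      using qU by (intro mult_right_mono) auto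
    also have "\<dots> \<le> card (cand U \<phi> w)"
      using cand w by blast
    \<comment> \<open>The forbidden choices fill less than the fraction \<open>q ^ card W\<close> of
      \<open>P w\<close>: \<delta> for each later neighbour, and \<beta> / c because \<beta> is
      measured against \<open>V\<close>, of which \<open>P w\<close> may be only a fraction
      \<open>c\<close>.\<close>
    finally have "\<not> cand U \<phi> w \<subseteq> X \<union> (\<Union>v\<in>R. L v)"
      using card_mono[of "X \<union> (\<Union>v\<in>R. L v)" "cand U \<phi> w"] finR finL V by (auto simp: X_def)
    then obtain x where x: "x \<in> cand U \<phi> w" "x \<notin> X" "\<And>v. v \<in> R \<Longrightarrow> x \<notin> L v"
      by blast
    have xP: "x \<in> P w" and xE: "\<And>u. u \<in> U \<Longrightarrow> adj u w \<Longrightarrow> (\<phi> u, x) \<in> E"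
      using x(1) by (auto simp: cand_def)
    define \<psi> where "\<psi> = \<phi>(w := x)"
    have \<psi>: "\<psi> w = x" "\<And>u. u \<in> U \<Longrightarrow> \<psi> u = \<phi> u"
      using w by (auto simp: \<psi>_def)
    have "good (insert w U) \<psi>"
      using x(2) xP P[OF w(2)] by (auto simp: X_def \<psi>_def)
    moreover have "\<psi> u \<in> P u" if "u \<in> insert w U" for u
      using that \<psi> xP \<phi>P by auto
    moreover have "(\<psi> u, \<psi> v) \<in> E" if uv: "u \<in> insert w U" "v \<in> insert w U" "adj u v" for u v
    proof -
      consider "u \<in> U" "v \<in> U" | "u \<in> U" "v = w" | "u = w" "v \<in> U"
        using uv adj(2) by blast
      then show ?thesis
      proof cases
        case 3
        then have "(\<phi> v, x) \<in> E"
          using xE adj(1) uv(3) by blast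
        then show ?thesis
          using 3 \<psi> symD[OF E] by simp
      qed (use uv \<psi> xE \<phi>E in auto)
    qed
    moreover have "real (card (cand (insert w U) \<psi> v)) \<ge> q ^ card (insert w U) * card (P v)"
      if v: "v \<in> W - insert w U" for v
    proof -
      have old: "real (card (cand U \<phi> v)) \<ge> q ^ card U * card (P v)"
        using cand v by blast
      have sz: "q ^ card (insert w U) = q * q ^ card U"
        using insert.hyps by simp
      show ?thesis
      proof (cases "adj w v")
        case True
        then have "x \<notin> L v"
          using x(3) v by (auto simp: R_def)
        then have "real (card {y \<in> cand U \<phi> v. (x, y) \<in> E}) \<ge> q * card (cand U \<phi> v)"
          using x(1) by (auto simp: L_def)
        moreover have "cand (insert w U) \<psi> v = {y \<in> cand U \<phi> v. (x, y) \<in> E}"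
          using True \<psi> by (auto simp: cand_def)
        moreover have "q * card (cand U \<phi> v) \<ge> q * (q ^ card U * card (P v))"
          using old pos by (intro mult_left_mono) auto
        ultimately show ?thesis
          unfolding sz by (simp add: mult.assoc)
      next
        case False
        then have "cand (insert w U) \<psi> v = cand U \<phi> v"
          using \<psi> by (auto simp: cand_def)
        moreover have "q * q ^ card U * card (P v) \<le> 1 * q ^ card U * card (P v)"
          using pos by (intro mult_right_mono) auto
        ultimately show ?thesis
          unfolding sz using old by simp
      qed
    qed
    ultimately show ?case
      by blast
  qed
  from this[OF W subset_refl] obtain \<phi> where "good W \<phi>"
    and "\<forall>u\<in>W. \<forall>w\<in>W. adj u w \<longrightarrow> (\<phi> u, \<phi> w) \<in> E"
    by (elim exE conjE)
  then show thesis
    by (intro that) simp_all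
qed

section \<open>Packings of edge-disjoint graphs\<close>

text \<open>The copies are described by a bound \<open>f\<close> on their order instead of an
  isomorphism to a fixed graph; this is the form in which the counting uses them.\<close>

locale packing =
  fixes n k f :: nat and Fs :: "nat \<Rightarrow> nat ugraph"
  assumes simple: "i < k \<Longrightarrow> simple_graph (Fs i)"
    and verts_less: "i < k \<Longrightarrow> verts (Fs i) \<subseteq> {..<n}"
    and card_verts: "i < k \<Longrightarrow> card (verts (Fs i)) \<le> f"
    and no_isolated: "i < k \<Longrightarrow> no_isolated_vertices (Fs i)"
    and edges_disjoint: "i < k \<Longrightarrow> j < k \<Longrightarrow> i \<noteq> j \<Longrightarrow> edges (Fs i) \<inter> edges (Fs j) = {}"
begin

definition copies_at :: "nat \<Rightarrow> nat set" where
  "copies_at v = {i. i < k \<and> v \<in> verts (Fs i)}"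

definition joint :: "nat \<Rightarrow> nat \<Rightarrow> nat set" where
  "joint u v = (\<Union>i\<in>copies_at u \<inter> copies_at v. verts (Fs i))"

text \<open>Every edge of the union appears in both orientations, matching the bipartite counts in
  \<open>dens\<close>.\<close>

definition links :: "(nat \<times> nat) set" where
  "links = {(x, y). \<exists>i<k. {x, y} \<in> edges (Fs i)}"

lemma joint_commute: "joint u v = joint v u"
  by (simp add: joint_def Int_commute)

lemma finite_verts: "i < k \<Longrightarrow> finite (verts (Fs i))"
  using simple by (simp add: simple_graph_def)

lemma edge_subset: "i < k \<Longrightarrow> e \<in> edges (Fs i) \<Longrightarrow> e \<subseteq> verts (Fs i)"
  using simple by (auto simp: simple_graph_def)

lemma edge_unique: "i < k \<Longrightarrow> j < k \<Longrightarrow> e \<in> edges (Fs i) \<Longrightarrow> e \<in> edges (Fs j) \<Longrightarrow> i = j"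
  using edges_disjoint by blast

lemma finite_copies_at: "finite (copies_at v)"
  by (simp add: copies_at_def)

lemma finite_joint: "finite (joint u v)"
  unfolding joint_def using finite_copies_at finite_verts by (auto simp: copies_at_def)

lemma links_subset: "links \<subseteq> {..<n} \<times> {..<n}"
proof clarify
  fix x y assume "(x, y) \<in> links"
  then obtain i where "i < k" "{x, y} \<in> edges (Fs i)"
    by (auto simp: links_def)
  then show "x \<in> {..<n} \<and> y \<in> {..<n}"
    using edge_subset verts_less by blast
qed

text \<open>As the copies have no isolated vertices, those through \<open>v\<close> use distinct edges at \<open>v\<close>.\<close>

lemma card_copies_at: "card (copies_at v) \<le> n"
proof -
  have "\<exists>y. {v, y} \<in> edges (Fs i)" if "i \<in> copies_at v" for i
  proof -
    have i: "i < k" "v \<in> verts (Fs i)"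
      using that by (auto simp: copies_at_def)
    then obtain e where e: "e \<in> edges (Fs i)" "v \<in> e"
      using no_isolated unfolding no_isolated_vertices_def by blast
    then have "card e = 2"
      using simple[OF i(1)] by (auto simp: simple_graph_def)
    then show ?thesis
      using e by (metis card_2_iff insert_commute insertE singletonD)
  qed
  then obtain y where y: "\<And>i. i \<in> copies_at v \<Longrightarrow> {v, y i} \<in> edges (Fs i)"
    by metis
  have "inj_on y (copies_at v)"
    using y edge_unique unfolding inj_on_def copies_at_def by (metis mem_Collect_eq)
  moreover have "y ` copies_at v \<subseteq> {..<n}"
    using y edge_subset verts_less unfolding copies_at_def by blast
  ultimately have "card (copies_at v) \<le> card {..<n}"
    by (intro card_inj_on_le) auto
  then show ?thesis
    by simp
qed

text \<open>The indicator form, summed over the copies at \<open>u\<close> alone, has an index set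
  free of \<open>v\<close>, so that a sum over \<open>v\<close> can be swapped with it.\<close>

lemma card_joint: "card (joint u v) \<le> (\<Sum>i\<in>copies_at u. f * of_bool (v \<in> verts (Fs i)))"
proof -
  have "card (joint u v) \<le> (\<Sum>i\<in>copies_at u \<inter> copies_at v. card (verts (Fs i)))"
    unfolding joint_def using finite_copies_at by (intro card_UN_le) auto
  also have "\<dots> \<le> (\<Sum>i\<in>copies_at u \<inter> copies_at v. f * of_bool (v \<in> verts (Fs i)))"
    by (rule sum_mono) (auto simp: copies_at_def card_verts)
  also have "\<dots> \<le> (\<Sum>i\<in>copies_at u. f * of_bool (v \<in> verts (Fs i)))"
    by (rule sum_mono2) (auto simp: finite_copies_at)
  finally show ?thesis .
qed

text \<open>Double counting followed by Markov's inequality: at most \<open>n\<close> copies contain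
  \<open>u\<close>, and each adds at most \<open>f\<close> to \<open>joint u v\<close> for each of
  its at most \<open>f\<close> vertices \<open>v\<close>. For \<open>t\<close> a positive multiple
  of \<open>n\<close>, only boundedly many \<open>v\<close> are bad.\<close>

lemma few_large_joints:
  fixes t :: real
  shows "t * card {v \<in> {..<n}. card (joint u v) > t} \<le> f\<^sup>2 * n"
proof -
  let ?T = "{v \<in> {..<n}. card (joint u v) > t}"
  have "(\<Sum>v<n. card (joint u v)) \<le> (\<Sum>v<n. \<Sum>i\<in>copies_at u. f * of_bool (v \<in> verts (Fs i)))"
    by (rule sum_mono) (rule card_joint)
  also have "\<dots> = (\<Sum>i\<in>copies_at u. \<Sum>v<n. f * of_bool (v \<in> verts (Fs i)))"
    by (rule sum.swap)
  also have "\<dots> = (\<Sum>i\<in>copies_at u. f * card (verts (Fs i)))"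
  proof (rule sum.cong[OF refl])
    fix i assume "i \<in> copies_at u"
    then have "{..<n} \<inter> {v. v \<in> verts (Fs i)} = verts (Fs i)"
      using verts_less by (auto simp: copies_at_def)
    then show "(\<Sum>v<n. f * of_bool (v \<in> verts (Fs i))) = f * card (verts (Fs i))"
      unfolding of_bool_def by (simp add: sum.If_cases flip: sum_distrib_left)
  qed
  also have "\<dots> \<le> (\<Sum>i\<in>copies_at u. f * f)"
    by (rule sum_mono) (simp add: copies_at_def card_verts)
  also have "\<dots> \<le> f\<^sup>2 * n"
    using card_copies_at[of u] by (simp add: power2_eq_square)
  finally have le: "(\<Sum>v<n. card (joint u v)) \<le> f\<^sup>2 * n" .
  have "t * card ?T = (\<Sum>v\<in>?T. t)"
    by simp
  also have "\<dots> \<le> (\<Sum>v\<in>?T. real (card (joint u v)))"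
    by (rule sum_mono) auto
  also have "\<dots> \<le> (\<Sum>v<n. real (card (joint u v)))"
    by (rule sum_mono2) auto
  also have "\<dots> \<le> f\<^sup>2 * n"
    using le by (simp flip: of_nat_sum of_nat_mult of_nat_power)
  finally show ?thesis .
qed

text \<open>Two edges of \<open>G\<close> with a common end \<open>w\<close> can be mapped into the same copy only by sending
  \<open>w\<close> into the joint neighbourhood of the images of the two other ends. Keeping these
  neighbourhoods small leaves most choices for \<open>w\<close>.\<close>

definition spread_rainbow :: "'b ugraph \<Rightarrow> real \<Rightarrow> 'b set \<Rightarrow> ('b \<Rightarrow> nat) \<Rightarrow> bool" where
  "spread_rainbow G t U \<phi> \<longleftrightarrow> inj_on \<phi> U \<and>
     (\<forall>u\<in>U. \<forall>v\<in>U. u \<noteq> v \<longrightarrow> real (card (joint (\<phi> u) (\<phi> v))) \<le> t) \<and>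
     (\<forall>i<k. \<forall>e\<in>edges G. \<forall>e'\<in>edges G. e \<subseteq> U \<longrightarrow> e' \<subseteq> U \<longrightarrow>
        \<phi> ` e \<in> edges (Fs i) \<longrightarrow> \<phi> ` e' \<in> edges (Fs i) \<longrightarrow> e = e')"

text \<open>The four summands are the four ways in which a choice \<open>x\<close> for
  \<open>w\<close> can fail: it repeats an image; it has a large \<open>joint\<close> with one; it
  lies in the copy of an edge between two images; or it lies in a common copy of two images, so that
  two new edges at \<open>w\<close> could share that copy. The last set is small because
  \<open>U\<close> is already spread.\<close>

lemma spread_rainbow_step:
  fixes \<phi> :: "'b \<Rightarrow> nat" and t B :: real
  assumes G: "simple_graph G" and U: "finite U" "w \<notin> U" and good: "spread_rainbow G t U \<phi>"
    and B: "\<And>v. card {u \<in> {..<n}. card (joint v u) > t} \<le> B" and t: "t \<ge> 0"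
  shows "card {x \<in> {..<n}. \<not> spread_rainbow G t (insert w U) (\<phi>(w := x))}
    \<le> card U + card U * B + (card U)\<^sup>2 * f + (card U)\<^sup>2 * t"
proof -
  define J where "J u = {x \<in> {..<n}. card (joint (\<phi> u) x) > t}" for u
  \<comment> \<open>By edge-disjointness at most one copy contains the edge between two given
    images, hence at most \<open>f\<close> vertices are banned for each pair.\<close>
  define K where "K = (\<lambda>(u, v). \<Union>i\<in>{i. i < k \<and> {\<phi> u, \<phi> v} \<in> edges (Fs i)}. verts (Fs i))"
  define D where "D = {(u, v) \<in> U \<times> U. u \<noteq> v}"
  let ?forb = "\<phi> ` U \<union> (\<Union>u\<in>U. J u) \<union> (\<Union>p\<in>U \<times> U. K p) \<union> (\<Union>(u, v)\<in>D. joint (\<phi> u) (\<phi> v))"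
  have two: "card e = 2" if "e \<in> edges G" for e
    using G that by (simp add: simple_graph_def)
  have inj: "inj_on \<phi> U"
    and spread: "\<And>u v. u \<in> U \<Longrightarrow> v \<in> U \<Longrightarrow> u \<noteq> v \<Longrightarrow> card (joint (\<phi> u) (\<phi> v)) \<le> t"
    and rainbow: "\<And>i e e'. i < k \<Longrightarrow> e \<in> edges G \<Longrightarrow> e' \<in> edges G \<Longrightarrow> e \<subseteq> U \<Longrightarrow> e' \<subseteq> U \<Longrightarrow>
      \<phi> ` e \<in> edges (Fs i) \<Longrightarrow> \<phi> ` e' \<in> edges (Fs i) \<Longrightarrow> e = e'"
    using good by (auto simp: spread_rainbow_def)
  have "spread_rainbow G t (insert w U) (\<phi>(w := x))" if x: "x < n" "x \<notin> ?forb" for x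
  proof -
    define \<psi> where "\<psi> = \<phi>(w := x)"
    have \<psi>: "\<psi> w = x" "\<And>u. u \<in> U \<Longrightarrow> \<psi> u = \<phi> u"
      using U by (auto simp: \<psi>_def)
    have img: "\<psi> ` e = \<phi> ` e" if "e \<subseteq> U" for e
      using that \<psi>(2) by (auto intro!: image_cong)
    have new: "\<exists>v\<in>U. e = {w, v}" if "e \<in> edges G" "e \<subseteq> insert w U" "\<not> e \<subseteq> U" for e
      using two[OF that(1)] that(2,3) by (auto simp: card_2_iff)
    \<comment> \<open>An edge inside \<open>U\<close> and an edge at \<open>w\<close> in the same
      copy would put \<open>x\<close> into that copy, which \<open>K\<close> forbids.\<close>
    have old_new: False
      if i: "i < k" "e \<in> edges G" "e \<subseteq> U" "\<psi> ` e \<in> edges (Fs i)" "\<psi> ` {w, v} \<in> edges (Fs i)"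
      for i e v
    proof -
      obtain a b where ab: "e = {a, b}"
        using two[OF i(2)] by (auto simp: card_2_iff)
      then have "a \<in> U" "b \<in> U" "{\<phi> a, \<phi> b} \<in> edges (Fs i)"
        using i \<psi>(2) by auto
      moreover have "x \<in> verts (Fs i)"
        using edge_subset[OF i(1,5)] \<psi> by auto
      ultimately have "x \<in> K (a, b)" "(a, b) \<in> U \<times> U"
        using i(1) by (auto simp: K_def)
      then show False
        using x(2) by blast
    qed
    have inj': "inj_on \<psi> (insert w U)"
    proof -
      have "inj_on \<psi> U"
        using inj inj_on_cong[of U \<psi> \<phi>] \<psi>(2) by blast
      moreover have "\<psi> w \<notin> \<psi> ` U"
        using x(2) \<psi>(1) img[of U] by blast
      ultimately show ?thesis
        using U(2) by simp
    qed
    have spread': "card (joint (\<psi> u) (\<psi> v)) \<le> t"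
      if uv: "u \<in> insert w U" "v \<in> insert w U" "u \<noteq> v" for u v
    proof -
      have J: "card (joint (\<phi> u) x) \<le> t" if "u \<in> U" for u
        using that x by (force simp: J_def not_less)
      consider "u \<in> U" "v \<in> U" | "u \<in> U" "v = w" | "u = w" "v \<in> U"
        using uv by blast
      then show ?thesis
        by cases (use \<psi> J spread uv joint_commute in auto)
    qed
    have rainbow': "e = e'"
      if e: "i < k" "e \<in> edges G" "e' \<in> edges G" "e \<subseteq> insert w U" "e' \<subseteq> insert w U"
        "\<psi> ` e \<in> edges (Fs i)" "\<psi> ` e' \<in> edges (Fs i)" for i e e'
    proof -
      consider "e \<subseteq> U" "e' \<subseteq> U" | "e \<subseteq> U" "\<not> e' \<subseteq> U" | "\<not> e \<subseteq> U" "e' \<subseteq> U" | "\<not> e \<subseteq> U" "\<not> e' \<subseteq> U"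
        by blast
      then show ?thesis
      proof cases
        case 1
        then show ?thesis
          using rainbow e img by metis
      next
        case 2
        then show ?thesis
          using new[of e'] old_new e by blast
      next
        case 3
        then show ?thesis
          using new[of e] old_new e by blast
      next
        \<comment> \<open>Two distinct edges at \<open>w\<close> in one copy would place
          \<open>x\<close> in the \<open>joint\<close> of the images of their other ends.\<close>
        case 4
        obtain v v' where v: "v \<in> U" "e = {w, v}" "v' \<in> U" "e' = {w, v'}"
          using new[of e] new[of e'] e 4 by blast
        have "\<phi> v \<in> verts (Fs i)" "\<phi> v' \<in> verts (Fs i)" "x \<in> verts (Fs i)"
          using edge_subset[OF e(1,6)] edge_subset[OF e(1,7)] v \<psi> by auto
        then have "x \<in> joint (\<phi> v) (\<phi> v')"
          using e(1) by (auto simp: joint_def copies_at_def)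
        then have "v = v'"
          using x(2) v by (auto simp: D_def)
        then show ?thesis
          using v by simp
      qed
    qed
    show ?thesis
      unfolding spread_rainbow_def \<psi>_def[symmetric]
      by (intro conjI ballI allI impI) (fact inj' | rule spread' rainbow'; assumption)+
  qed
  then have sub: "{x \<in> {..<n}. \<not> spread_rainbow G t (insert w U) (\<phi>(w := x))} \<subseteq> ?forb"
    by blast
  have K: "finite (K p) \<and> card (K p) \<le> f" for p
  proof -
    obtain u v where p: "p = (u, v)"
      by fastforce
    show ?thesis
    proof (cases "\<exists>i<k. {\<phi> u, \<phi> v} \<in> edges (Fs i)")
      case True
      then obtain i where i: "i < k" "{\<phi> u, \<phi> v} \<in> edges (Fs i)"
        by blast
      then have "{i. i < k \<and> {\<phi> u, \<phi> v} \<in> edges (Fs i)} = {i}"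
        using edge_unique by blast
      then show ?thesis
        using i finite_verts card_verts by (simp add: K_def p)
    next
      case False
      then have "K p = {}"
        by (auto simp: K_def p)
      then show ?thesis
        by simp
    qed
  qed
  have finD: "finite D" and cardD: "card D \<le> (card U)\<^sup>2"
    using U card_mono[of "U \<times> U" D]
    by (auto simp: D_def card_cartesian_product power2_eq_square intro: finite_subset[of _ "U \<times> U"])
  have finJ: "finite (J u)" for u
    by (simp add: J_def)
  have "finite ?forb"
    using U finD K finJ finite_joint by auto
  then have "card {x \<in> {..<n}. \<not> spread_rainbow G t (insert w U) (\<phi>(w := x))} \<le> card ?forb"
    using sub by (rule card_mono)
  also have "\<dots> \<le> card (\<phi> ` U) + card (\<Union>u\<in>U. J u) + card (\<Union>p\<in>U \<times> U. K p)
      + card (\<Union>(u, v)\<in>D. joint (\<phi> u) (\<phi> v))"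
    by (meson card_Un_le order_trans add_le_mono1)
  finally have "real (card {x \<in> {..<n}. \<not> spread_rainbow G t (insert w U) (\<phi>(w := x))})
      \<le> real (card (\<phi> ` U)) + real (card (\<Union>u\<in>U. J u)) + real (card (\<Union>p\<in>U \<times> U. K p))
      + real (card (\<Union>(u, v)\<in>D. joint (\<phi> u) (\<phi> v)))"
    by (simp flip: of_nat_add)
  also have "\<dots> \<le> card U + card U * B + (card U)\<^sup>2 * f + (card U)\<^sup>2 * t"
  proof (intro add_mono)
    show "real (card (\<phi> ` U)) \<le> real (card U)"
      using U by (simp add: card_image_le)
    have "real (card (\<Union>u\<in>U. J u)) \<le> real (\<Sum>u\<in>U. card (J u))"
      using U by (simp only: of_nat_le_iff card_UN_le)
    also have "\<dots> = (\<Sum>u\<in>U. real (card (J u)))"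
      by simp
    also have "\<dots> \<le> (\<Sum>u\<in>U. B)"
      by (rule sum_mono) (use B in \<open>simp only: J_def\<close>)
    finally show "real (card (\<Union>u\<in>U. J u)) \<le> card U * B"
      by simp
    have "card (\<Union>p\<in>U \<times> U. K p) \<le> (\<Sum>p\<in>U \<times> U. card (K p))"
      using U by (intro card_UN_le) auto
    also have "\<dots> \<le> (\<Sum>p\<in>U \<times> U. f)"
      by (rule sum_mono) (simp add: K)
    finally show "real (card (\<Union>p\<in>U \<times> U. K p)) \<le> real ((card U)\<^sup>2 * f)"
      by (simp add: card_cartesian_product power2_eq_square flip: of_nat_mult)
    have "real (card (\<Union>(u, v)\<in>D. joint (\<phi> u) (\<phi> v)))
        \<le> real (\<Sum>p\<in>D. card (case p of (u, v) \<Rightarrow> joint (\<phi> u) (\<phi> v)))"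
      using finD by (simp only: of_nat_le_iff card_UN_le)
    also have "\<dots> = (\<Sum>p\<in>D. real (card (case p of (u, v) \<Rightarrow> joint (\<phi> u) (\<phi> v))))"
      by simp
    also have "\<dots> \<le> (\<Sum>p\<in>D. t)"
      by (rule sum_mono) (auto simp: D_def spread)
    also have "\<dots> = real (card D) * t"
      by simp
    also have "\<dots> \<le> real ((card U)\<^sup>2) * t"
      using cardD t by (intro mult_right_mono) (simp_all only: of_nat_le_iff)
    finally show "real (card (\<Union>(u, v)\<in>D. joint (\<phi> u) (\<phi> v))) \<le> real ((card U)\<^sup>2) * t" .
  qed
  finally show ?thesis .
qed

text \<open>One failing link from each copy would give \<open>k\<close> different links, as an edge
  determines its copy.\<close>

lemma clean_copy:
  assumes "card {(x, y) \<in> links. \<not> ok x y} < k"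
  obtains i where "i < k" "\<And>x y. {x, y} \<in> edges (Fs i) \<Longrightarrow> ok x y"
proof (rule ccontr)
  let ?B = "{(x, y) \<in> links. \<not> ok x y}"
  assume "\<not> thesis"
  then have "\<forall>i<k. \<exists>p. {fst p, snd p} \<in> edges (Fs i) \<and> \<not> ok (fst p) (snd p)"
    using that by (metis fst_conv snd_conv)
  then obtain p where p: "\<And>i. i < k \<Longrightarrow> {fst (p i), snd (p i)} \<in> edges (Fs i)"
    "\<And>i. i < k \<Longrightarrow> \<not> ok (fst (p i)) (snd (p i))"
    by metis
  have "inj_on p {..<k}"
    using p(1) edge_unique unfolding inj_on_def by (metis lessThan_iff)
  moreover have "p ` {..<k} \<subseteq> ?B"
  proof (rule image_subsetI)
    fix i assume "i \<in> {..<k}"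
    then show "p i \<in> ?B"
      using p[of i] by (cases "p i") (auto simp: links_def)
  qed
  moreover have "finite ?B"
    by (rule finite_subset[of _ "{..<n} \<times> {..<n}"]) (use links_subset in auto)
  ultimately have "card {..<k} \<le> card ?B"
    by (rule card_inj_on_le)
  then show False
    using assms by simp
qed

end

section \<open>Choice of constants and the rainbow embedding\<close>

text \<open>\<open>F\<close> is represented by the bound \<open>f\<close> and by homomorphisms from
  \<open>G\<close> into every copy, so the threshold for \<open>n\<close> depends only on
  \<epsilon>, \<open>G\<close> and \<open>f\<close>.\<close>

theorem dense_packing_rainbow_embedding:
  fixes G :: "'b ugraph" and \<epsilon> :: real and f :: nat
  assumes G: "simple_graph G" "no_isolated_vertices G" and e: "\<epsilon> > 0"
  shows "\<forall>\<^sub>F n in sequentially. \<forall>k Fs. packing n k f Fs \<longrightarrow> \<epsilon> * n\<^sup>2 < k \<longrightarrow>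
    (\<forall>i<k. \<exists>h. graph_hom h G (Fs i)) \<longrightarrow>
    (\<exists>\<phi>. inj_on \<phi> (verts G) \<and> (\<forall>e\<in>edges G. \<exists>i<k. \<phi> ` e \<in> edges (Fs i)) \<and>
      (\<forall>i<k. \<forall>e\<in>edges G. \<forall>e'\<in>edges G.
        \<phi> ` e \<in> edges (Fs i) \<longrightarrow> \<phi> ` e' \<in> edges (Fs i) \<longrightarrow> e = e'))"
proof -
  define m where "m = card (verts G)"
  \<comment> \<open>Cleaning discards a fraction \<delta> + (q + \<delta>) + 2 (\<epsilon> / 8) of
    all pairs; with \<open>q \<le> \<epsilon> / 8\<close> and \<open>\<delta> \<le> q / 2\<close>
    this is at most \<epsilon> / 2. The minimum with 1 ensures \<open>q \<le> 1\<close>.\<close>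
  define q where "q = min \<epsilon> 1 / 8"
  \<comment> \<open>Small enough for three bounds at once: \<open>\<delta> \<le> q / 2\<close> for
    the cleaning, \<open>\<delta> \<le> q ^ m\<close> to keep candidate sets within reach of
    regularity, and \<open>m * \<delta> < q ^ m / 2\<close> for half of the greedy budget.\<close>
  define \<delta> where "\<delta> = q * q ^ m / (2 * (real m + 1))"
  have q: "0 < q" "q \<le> 1" "q \<le> \<epsilon> / 8"
    using e by (auto simp: q_def)
  have qm: "0 < q ^ m" "q ^ m \<le> 1"
    using q by (auto simp: power_le_one)
  have \<delta>_pos: "0 < \<delta>"
    using q qm by (simp add: \<delta>_def)
  have \<delta>_mult: "(real m + 1) * \<delta> = q * q ^ m / 2"
    by (simp add: \<delta>_def field_simps)
  have q_qm: "q * q ^ m \<le> q" "q * q ^ m \<le> q ^ m"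
    using mult_left_mono[of "q ^ m" 1 q] mult_right_mono[of q 1 "q ^ m"] q qm by auto
  have \<delta>_le: "\<delta> \<le> q / 2" "\<delta> \<le> q ^ m" "real m * \<delta> < q ^ m / 2"
  proof -
    have "0 \<le> real m * \<delta>" "real m * \<delta> + \<delta> = q * q ^ m / 2"
      using \<delta>_pos \<delta>_mult by (simp_all add: distrib_right)
    then show "\<delta> \<le> q / 2" "\<delta> \<le> q ^ m" "real m * \<delta> < q ^ m / 2"
      using q_qm qm \<delta>_pos by linarith+
  qed
  obtain c :: real where c: "c > 0" and part: "\<And>(V :: nat set) E. finite V \<Longrightarrow>
    \<exists>P. (\<forall>x. P x \<subseteq> V) \<and>
      card {(x, y) \<in> E \<inter> V \<times> V. \<not> clean_pair \<delta> (q + \<delta>) (c * card V) E (P x) (P y)}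
        \<le> (\<delta> + (q + \<delta>) + 2 * (\<epsilon> / 8)) * (card V)\<^sup>2"
    using regular_partition_cleaning[of \<delta> "q + \<delta>" "\<epsilon> / 8", where ?'a = nat] \<delta>_pos q e by auto
  \<comment> \<open>The other half of the greedy budget \<open>q ^ m\<close>, rescaled by the cell
    fraction \<open>c\<close>: \<beta> / c = q ^ m / 2.\<close>
  define \<beta> where "\<beta> = c * q ^ m / 2"
  \<comment> \<open>The rainbow loss per step has a part linear in \<open>n\<close>, at most
    \<open>m\<^sup>2 * \<eta> * n\<close>, and a part at most \<open>A\<close>, free of
    \<open>n\<close>. The choice of \<eta> makes the first at most \<beta> n / 2, and
    \<open>n \<ge> N\<close> does the same for the second.\<close>
  define \<eta> where "\<eta> = \<beta> / (2 * ((real m)\<^sup>2 + 1))"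
  define A where "A = real m + m * (f\<^sup>2 / \<eta>) + m\<^sup>2 * f"
  define N where "N = nat \<lceil>2 * A / \<beta>\<rceil> + 1"
  have \<beta>: "\<beta> > 0"
    using c qm by (simp add: \<beta>_def)
  have m1: "(real m)\<^sup>2 + 1 > 0"
    by (simp add: add_nonneg_pos)
  have \<eta>: "\<eta> > 0"
    using \<beta> m1 by (simp add: \<eta>_def)
  have \<eta>m: "(real m)\<^sup>2 * \<eta> \<le> \<beta> / 2"
  proof -
    have "s * (\<beta> / (2 * s)) = \<beta> / 2" if "s > 0" for s
      using that by simp
    from this[OF m1] have "((real m)\<^sup>2 + 1) * \<eta> = \<beta> / 2"
      by (simp only: \<eta>_def)
    then show ?thesis
      using \<eta> by (simp add: distrib_right)
  qed
  show ?thesis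
    unfolding eventually_sequentially
  proof (rule exI[of _ N], intro allI impI)
    fix n k Fs
    assume N: "N \<le> n" and "packing n k f Fs" and k: "\<epsilon> * n\<^sup>2 < k"
      and "\<forall>i<k. \<exists>h. graph_hom h G (Fs i)"
    then have hom: "\<exists>h. graph_hom h G (Fs i)" if "i < k" for i
      using that by blast
    interpret packing n k f Fs by fact
    have n: "n > 0" "2 * A / \<beta> \<le> n"
      using N by (auto simp: N_def) linarith
    have An: "A + (real m)\<^sup>2 * (\<eta> * n) \<le> \<beta> * n"
    proof -
      have "A \<le> \<beta> / 2 * n"
        using n(2) \<beta> by (simp add: field_simps)
      moreover have "(real m)\<^sup>2 * \<eta> * n \<le> \<beta> / 2 * n"
        using \<eta>m by (rule mult_right_mono) simp
      ultimately show ?thesis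
        by (simp add: mult.assoc)
    qed
    obtain P :: "nat \<Rightarrow> nat set" where P: "\<And>x. P x \<subseteq> {..<n}" and
      bad: "card {(x, y) \<in> links \<inter> {..<n} \<times> {..<n}.
          \<not> clean_pair \<delta> (q + \<delta>) (c * card {..<n}) links (P x) (P y)}
        \<le> (\<delta> + (q + \<delta>) + 2 * (\<epsilon> / 8)) * (card {..<n})\<^sup>2"
      using part[of "{..<n}" links] by auto
    have "links \<inter> {..<n} \<times> {..<n} = links"
      using links_subset by blast
    then have "card {(x, y) \<in> links. \<not> clean_pair \<delta> (q + \<delta>) (c * n) links (P x) (P y)}
        \<le> (\<delta> + (q + \<delta>) + 2 * (\<epsilon> / 8)) * n\<^sup>2"
      using bad by simp
    also have "\<dots> \<le> \<epsilon> * n\<^sup>2"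
      using \<delta>_le q e by (intro mult_right_mono) auto
    also have "\<dots> < k"
      by (rule k)
    finally have "card {(x, y) \<in> links. \<not> clean_pair \<delta> (q + \<delta>) (c * n) links (P x) (P y)} < k"
      by (simp only: of_nat_less_iff)
    from clean_copy[OF this] obtain i where i: "i < k"
      and clean: "\<And>x y. {x, y} \<in> edges (Fs i) \<Longrightarrow>
        clean_pair \<delta> (q + \<delta>) (c * n) links (P x) (P y)"
      by metis
    obtain h where h: "\<And>u v. {u, v} \<in> edges G \<Longrightarrow> {h u, h v} \<in> edges (Fs i)"
      using hom[OF i] by (auto simp: graph_hom_def)
    have two: "card e = 2" "e \<subseteq> verts G" if "e \<in> edges G" for e
      using G(1) that by (auto simp: simple_graph_def)
    obtain \<phi> where \<phi>: "\<And>u w. u \<in> verts G \<Longrightarrow> w \<in> verts G \<Longrightarrow> {u, w} \<in> edges G \<Longrightarrow> (\<phi> u, \<phi> w) \<in> links"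
      and rainbow: "spread_rainbow G (\<eta> * n) (verts G) \<phi>"
    \<comment> \<open>\<open>P \<circ> h\<close> sends a vertex of \<open>G\<close> to the cell of
      its image in the clean copy. Several vertices of \<open>G\<close> may share a cell;
      injectivity comes from \<open>spread_rainbow\<close>.\<close>
    proof (rule regular_embedding[where W = "verts G" and V = "{..<n}" and E = links and P = "P \<circ> h"
          and adj = "\<lambda>u w. {u, w} \<in> edges G" and good = "spread_rainbow G (\<eta> * n)"
          and q = q and \<delta> = \<delta> and \<beta> = \<beta> and c = c])
      show "sym links"
        by (auto simp: sym_def links_def insert_commute)
      show "{w, u} \<in> edges G" if "{u, w} \<in> edges G" for u w
        using that by (simp add: insert_commute)
      show "{u, u} \<notin> edges G" for u
        using two[of "{u, u}"] by auto
      show "\<exists>u\<in>verts G. {u, w} \<in> edges G" if w: "w \<in> verts G" for w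
      proof -
        obtain e where e: "e \<in> edges G" "w \<in> e"
          using G(2) w by (auto simp: no_isolated_vertices_def)
        then obtain u where "e = {u, w}"
          using two(1)[of e] by (auto simp: card_2_iff)
        then show ?thesis
          using e two(2) by blast
      qed
      show "clean_pair \<delta> (q + \<delta>) (c * card {..<n}) links ((P \<circ> h) u) ((P \<circ> h) w)"
        if "{u, w} \<in> edges G" for u w
        using clean h that by simp
      show "card (verts G) * \<delta> + \<beta> / c < q ^ card (verts G)"
        using \<delta>_le(3) c by (simp add: \<beta>_def flip: m_def)
      \<comment> \<open>At \<open>U = {}\<close> the rainbow clause speaks only of edges contained
        in \<open>{}\<close>, and there are none.\<close>
      have "{} \<notin> edges G"
        using two(1)[of "{}"] by auto
      then show "spread_rainbow G (\<eta> * n) {} \<phi>" for \<phi>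
        unfolding spread_rainbow_def by (metis inj_on_empty empty_iff subset_empty)
      show "card {x \<in> {..<n}. \<not> spread_rainbow G (\<eta> * n) (insert w U) (\<phi>(w := x))}
          \<le> \<beta> * card {..<n}"
        if U: "U \<subseteq> verts G" "w \<in> verts G - U" and good: "spread_rainbow G (\<eta> * n) U \<phi>" for U w \<phi>
      proof -
        have fin: "finite (verts G)"
          using G by (simp add: simple_graph_def)
        then have Um: "finite U" "card U \<le> m"
          using finite_subset[OF U(1)] card_mono[OF _ U(1)] by (simp_all add: m_def)
        \<comment> \<open>At the threshold \<open>\<eta> * n\<close> the factor \<open>n\<close>
          cancels, leaving a constant.\<close>
        have B: "card {u \<in> {..<n}. card (joint v u) > \<eta> * n} \<le> f\<^sup>2 / \<eta>" for v
          using few_large_joints[of "\<eta> * n" v] n \<eta> by (simp add: field_simps)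
        have "card {x \<in> {..<n}. \<not> spread_rainbow G (\<eta> * n) (insert w U) (\<phi>(w := x))}
            \<le> card U + card U * (f\<^sup>2 / \<eta>) + (card U)\<^sup>2 * f + (card U)\<^sup>2 * (\<eta> * n)"
          using spread_rainbow_step[OF G(1) Um(1) _ good B] U \<eta> by simp
        also have "\<dots> \<le> real m + m * (f\<^sup>2 / \<eta>) + m\<^sup>2 * f + m\<^sup>2 * (\<eta> * n)"
        proof (intro add_mono mult_right_mono)
          have "(card U)\<^sup>2 \<le> m\<^sup>2"
            using Um(2) by (rule power_mono) simp
          then show "real ((card U)\<^sup>2 * f) \<le> real (m\<^sup>2 * f)" "real ((card U)\<^sup>2) \<le> real (m\<^sup>2)"
            by (simp_all only: of_nat_le_iff mult_le_mono1)
        qed (use Um(2) \<eta> in simp_all)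
        also have "\<dots> \<le> \<beta> * card {..<n}"
          using An by (simp add: A_def)
        finally show ?thesis .
      qed
      show "finite (verts G)"
        using G(1) by (simp add: simple_graph_def)
      show "(P \<circ> h) w \<subseteq> {..<n}" for w
        using P by simp
      show "{..<n} \<noteq> {}"
        using n(1) by blast
      show "\<delta> \<le> q ^ card (verts G)"
        using \<delta>_le(2) by (simp only: m_def)
      show "0 < q" "q \<le> 1" "0 < c" "0 < \<delta>" "0 \<le> \<beta>"
        using q c \<delta>_pos \<beta> by simp_all
      note result = that
      show ?thesis if emb: "\<And>u w. u \<in> verts G \<Longrightarrow> w \<in> verts G \<Longrightarrow> {u, w} \<in> edges G \<Longrightarrow> (\<phi> u, \<phi> w) \<in> links"
        "spread_rainbow G (\<eta> * n) (verts G) \<phi>" for \<phi>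
        by (rule result[OF emb])
    qed simp
    have "\<exists>i<k. \<phi> ` e \<in> edges (Fs i)" if e: "e \<in> edges G" for e
    proof -
      obtain u w where "e = {u, w}"
        using two(1)[OF e] by (auto simp: card_2_iff)
      then have "(\<phi> u, \<phi> w) \<in> links" "\<phi> ` e = {\<phi> u, \<phi> w}"
        using \<phi>[of u w] e two(2)[OF e] by auto
      then show ?thesis
        by (simp add: links_def)
    qed
    moreover have "inj_on \<phi> (verts G)"
      using rainbow by (simp add: spread_rainbow_def)
    moreover have "e = e'" if e: "i < k" "e \<in> edges G" "e' \<in> edges G"
        "\<phi> ` e \<in> edges (Fs i)" "\<phi> ` e' \<in> edges (Fs i)" for i e e'
    proof -
      have "\<forall>i<k. \<forall>e\<in>edges G. \<forall>e'\<in>edges G. e \<subseteq> verts G \<longrightarrow> e' \<subseteq> verts G \<longrightarrow>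
          \<phi> ` e \<in> edges (Fs i) \<longrightarrow> \<phi> ` e' \<in> edges (Fs i) \<longrightarrow> e = e'"
        using rainbow unfolding spread_rainbow_def by (elim conjE)
      from this[rule_format, OF e(1-3) two(2)[OF e(2)] two(2)[OF e(3)] e(4,5)] show ?thesis .
    qed
    ultimately show "\<exists>\<phi>. inj_on \<phi> (verts G) \<and> (\<forall>e\<in>edges G. \<exists>i<k. \<phi> ` e \<in> edges (Fs i)) \<and>
      (\<forall>i<k. \<forall>e\<in>edges G. \<forall>e'\<in>edges G.
        \<phi> ` e \<in> edges (Fs i) \<longrightarrow> \<phi> ` e' \<in> edges (Fs i) \<longrightarrow> e = e')"
      by (intro exI[of _ \<phi>]) simp
  qed
qed

section \<open>Transfer between embeddings and admissible families\<close>

lemma graph_iso_card_verts: "graph_iso H F \<Longrightarrow> card (verts H) = card (verts F)"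
  by (auto simp: graph_iso_def dest: bij_betw_same_card)

text \<open>The inverse of the isomorphism works: \<open>simple_graph F\<close> puts the ends of
  every edge into \<open>verts F\<close>, where the isomorphism controls adjacency.\<close>

lemma graph_iso_hom:
  assumes H: "simple_graph H" and F: "simple_graph F" and iso: "graph_iso H F"
  obtains g where "graph_hom g F H"
proof -
  obtain g where bij: "bij_betw g (verts H) (verts F)"
    and g: "\<And>u v. u \<in> verts H \<Longrightarrow> v \<in> verts H \<Longrightarrow> {u, v} \<in> edges H \<longleftrightarrow> {g u, g v} \<in> edges F"
    using iso by (auto simp: graph_iso_def)
  let ?g = "inv_into (verts H) g"
  have inv: "?g x \<in> verts H" "g (?g x) = x" if "x \<in> verts F" for x
    using bij that by (auto simp: bij_betw_def inv_into_into f_inv_into_f)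
  have "{?g x, ?g y} \<in> edges H" if "{x, y} \<in> edges F" for x y
  proof -
    have "x \<in> verts F" "y \<in> verts F"
      using F that by (auto simp: simple_graph_def)
    then show ?thesis
      using g[of "?g x" "?g y"] inv that by simp
  qed
  then have "graph_hom ?g F H"
    using inv by (auto simp: graph_hom_def)
  then show thesis
    by (rule that)
qed

lemma graph_iso_no_isolated:
  assumes F: "simple_graph F" "no_isolated_vertices F" and iso: "graph_iso H F"
  shows "no_isolated_vertices H"
  unfolding no_isolated_vertices_def
proof
  fix v assume v: "v \<in> verts H"
  obtain g where bij: "bij_betw g (verts H) (verts F)"
    and g: "\<And>u v. u \<in> verts H \<Longrightarrow> v \<in> verts H \<Longrightarrow> {u, v} \<in> edges H \<longleftrightarrow> {g u, g v} \<in> edges F"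
    using iso by (auto simp: graph_iso_def)
  have "g v \<in> verts F"
    using bij v by (auto simp: bij_betw_def)
  then obtain e where e: "e \<in> edges F" "g v \<in> e"
    using F by (auto simp: no_isolated_vertices_def)
  then obtain y where y: "e = {g v, y}"
    using F(1) by (auto simp: simple_graph_def card_2_iff insert_commute)
  then have "y \<in> verts F"
    using F(1) e by (auto simp: simple_graph_def)
  then obtain u where "u \<in> verts H" "y = g u"
    using bij by (auto simp: bij_betw_def)
  then have "{v, u} \<in> edges H"
    using g v e y by simp
  then show "\<exists>e\<in>edges H. v \<in> e"
    by blast
qed

text \<open>The subgraph is the image of \<open>G\<close> with exactly the image edges, not the
  induced one. Each of its vertices lies on an image edge, which places it in the union of the
  copies.\<close>

lemma rainbow_subgraph_of_embedding:
  fixes \<phi> :: "'b \<Rightarrow> 'a"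
  assumes G: "simple_graph G" "no_isolated_vertices G"
    and Fs: "\<And>i. i < k \<Longrightarrow> simple_graph (Fs i)" and inj: "inj_on \<phi> (verts G)"
    and img: "\<And>e. e \<in> edges G \<Longrightarrow> \<exists>i<k. \<phi> ` e \<in> edges (Fs i)"
    and rainbow: "\<And>i e e'. i < k \<Longrightarrow> e \<in> edges G \<Longrightarrow> e' \<in> edges G \<Longrightarrow>
      \<phi> ` e \<in> edges (Fs i) \<Longrightarrow> \<phi> ` e' \<in> edges (Fs i) \<Longrightarrow> e = e'"
  shows "\<exists>G'. subgraph G' (graph_Union k Fs) \<and> graph_iso G' G \<and>
    (\<forall>i<k. card (edges G' \<inter> edges (Fs i)) \<le> 1)"
proof (intro exI conjI allI impI)
  define G' where "G' = (\<phi> ` verts G, (`) \<phi> ` edges G)"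
  have edge: "e \<subseteq> verts G" "card e = 2" if "e \<in> edges G" for e
    using G(1) that by (auto simp: simple_graph_def)
  have "simple_graph G'"
    using G(1) edge inj by (auto simp: simple_graph_def G'_def card_image inj_on_subset)
  moreover have "\<exists>i<k. \<phi> v \<in> verts (Fs i)" if "v \<in> verts G" for v
  proof -
    obtain e where e: "e \<in> edges G" "v \<in> e"
      using G(2) \<open>v \<in> verts G\<close> by (auto simp: no_isolated_vertices_def)
    then obtain i where i: "i < k" "\<phi> ` e \<in> edges (Fs i)"
      using img by blast
    then have "\<phi> ` e \<subseteq> verts (Fs i)"
      using Fs[of i] by (auto simp: simple_graph_def)
    then show ?thesis
      using i(1) e(2) by blast
  qed
  ultimately show "subgraph G' (graph_Union k Fs)"
    using img by (auto simp: subgraph_def graph_Union_def G'_def)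
  let ?g = "inv_into (verts G) \<phi>"
  have "bij_betw ?g (verts G') (verts G)"
    using inj by (simp add: G'_def bij_betw_inv_into inj_on_imp_bij_betw)
  moreover have "{x, y} \<in> edges G' \<longleftrightarrow> {?g x, ?g y} \<in> edges G" if xy: "x \<in> verts G'" "y \<in> verts G'" for x y
  proof -
    obtain u v where uv: "u \<in> verts G" "x = \<phi> u" "v \<in> verts G" "y = \<phi> v"
      using xy by (auto simp: G'_def)
    have "{x, y} \<in> edges G' \<longleftrightarrow> (\<exists>e\<in>edges G. \<phi> ` {u, v} = \<phi> ` e)"
      by (auto simp: G'_def uv)
    \<comment> \<open>Injectivity on \<open>verts G\<close> recovers an edge from its image.\<close>
    also have "\<dots> \<longleftrightarrow> {u, v} \<in> edges G"
      using uv edge inj_on_image_eq_iff[OF inj, of "{u, v}"] by auto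
    finally show ?thesis
      using uv inj by simp
  qed
  ultimately show "graph_iso G' G"
    by (auto simp: graph_iso_def)
  fix i assume "i < k"
  then have "e = e'" if "e \<in> edges G' \<inter> edges (Fs i)" "e' \<in> edges G' \<inter> edges (Fs i)" for e e'
    using rainbow[of i] that by (auto simp: G'_def)
  moreover have "finite (edges G')"
    using G(1) edge finite_subset[of "edges G" "Pow (verts G)"]
    by (auto simp: simple_graph_def G'_def)
  ultimately show "card (edges G' \<inter> edges (Fs i)) \<le> 1"
    using card_le_Suc0_iff_eq[of "edges G' \<inter> edges (Fs i)"] by simp
qed

theorem theorem8:
  fixes F :: "'a ugraph" and G :: "'b ugraph"
  assumes "simple_graph F" and "simple_graph G"
    and "verts F \<noteq> {}" and "verts G \<noteq> {}"
    and "no_isolated_vertices F" and "no_isolated_vertices G"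
    and "\<exists>h. graph_hom h G F"
  shows "(\<lambda>n. real (ex_family F n G)) \<in> o(\<lambda>n. (real n)\<^sup>2)"
proof (rule landau_o.smallI)
  fix c :: real assume "c > 0"
  then have ev: "\<forall>\<^sub>F n in sequentially. \<forall>k Fs. packing n k (card (verts F)) Fs \<longrightarrow> c * n\<^sup>2 < k \<longrightarrow>
    (\<forall>i<k. \<exists>h. graph_hom h G (Fs i)) \<longrightarrow>
    (\<exists>\<phi>. inj_on \<phi> (verts G) \<and> (\<forall>e\<in>edges G. \<exists>i<k. \<phi> ` e \<in> edges (Fs i)) \<and>
      (\<forall>i<k. \<forall>e\<in>edges G. \<forall>e'\<in>edges G.
        \<phi> ` e \<in> edges (Fs i) \<longrightarrow> \<phi> ` e' \<in> edges (Fs i) \<longrightarrow> e = e'))"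
    by (rule dense_packing_rainbow_embedding[OF assms(2,6)])
  have ne: "edges F \<noteq> {}"
    using assms(3,5) by (auto simp: no_isolated_vertices_def)
  obtain h where h: "graph_hom h G F"
    using assms(7) by blast
  have bound: "real (ex_family F n G) \<le> c * n\<^sup>2"
    if n: "\<forall>k Fs. packing n k (card (verts F)) Fs \<longrightarrow> c * n\<^sup>2 < k \<longrightarrow>
      (\<forall>i<k. \<exists>h. graph_hom h G (Fs i)) \<longrightarrow>
      (\<exists>\<phi>. inj_on \<phi> (verts G) \<and> (\<forall>e\<in>edges G. \<exists>i<k. \<phi> ` e \<in> edges (Fs i)) \<and>
      (\<forall>i<k. \<forall>e\<in>edges G. \<forall>e'\<in>edges G.
        \<phi> ` e \<in> edges (Fs i) \<longrightarrow> \<phi> ` e' \<in> edges (Fs i) \<longrightarrow> e = e'))" for n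
  proof (rule ccontr)
    define k where "k = ex_family F n G"
    assume "\<not> ?thesis"
    then have k: "c * n\<^sup>2 < k"
      by (simp add: k_def)
    \<comment> \<open>The maximum is attained, so it suffices to refute an admissible family of
      exactly this size.\<close>
    have "k \<in> {k. \<exists>Fs. admissible_family F n G k Fs}"
      unfolding k_def ex_family_def
      using finite_admissible[OF assms(1) ne, of n G] zero_admissible[OF assms(4), of F n]
      by (intro Max_in) blast+
    then obtain Fs where adm: "admissible_family F n G k Fs"
      by blast
    have sub: "simple_graph (Fs i)" "verts (Fs i) \<subseteq> {..<n}" and iso: "graph_iso (Fs i) F"
      if "i < k" for i
      using adm that by (auto simp: admissible_family_def subgraph_def complete_graph_def)
    have pack: "packing n k (card (verts F)) Fs"
    proof
      show "edges (Fs i) \<inter> edges (Fs j) = {}" if "i < k" "j < k" "i \<noteq> j" for i j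
        using adm that by (simp add: admissible_family_def)
      show "card (verts (Fs i)) \<le> card (verts F)" if "i < k" for i
        using graph_iso_card_verts[OF iso[OF that]] by simp
      show "no_isolated_vertices (Fs i)" if "i < k" for i
        using graph_iso_no_isolated[OF assms(1,5) iso[OF that]] .
    qed (rule sub, assumption)+
    have homs: "\<exists>h. graph_hom h G (Fs i)" if i: "i < k" for i
    proof -
      obtain g where "graph_hom g F (Fs i)"
        using graph_iso_hom[OF sub(1)[OF i] assms(1) iso[OF i]] by metis
      then have "graph_hom (g \<circ> h) G (Fs i)"
        using h by (simp add: graph_hom_def image_subset_iff)
      then show ?thesis
        by blast
    qed
    have homs': "\<forall>i<k. \<exists>h. graph_hom h G (Fs i)"
      using homs by simp
    from n[THEN spec, THEN spec, THEN mp, OF pack, THEN mp, OF k, THEN mp, OF homs']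
    obtain \<phi> where inj: "inj_on \<phi> (verts G)" and img: "\<forall>e\<in>edges G. \<exists>i<k. \<phi> ` e \<in> edges (Fs i)"
      and rainbow: "\<forall>i<k. \<forall>e\<in>edges G. \<forall>e'\<in>edges G.
        \<phi> ` e \<in> edges (Fs i) \<longrightarrow> \<phi> ` e' \<in> edges (Fs i) \<longrightarrow> e = e'"
      by (elim exE conjE)
    have "\<exists>G'. subgraph G' (graph_Union k Fs) \<and> graph_iso G' G \<and>
        (\<forall>i<k. card (edges G' \<inter> edges (Fs i)) \<le> 1)"
      using img rainbow by (intro rainbow_subgraph_of_embedding[OF assms(2,6) sub(1) inj]) simp_all
    then show False
      using adm by (simp add: admissible_family_def)
  qed
  show "\<forall>\<^sub>F n in sequentially. norm (real (ex_family F n G)) \<le> c * norm ((real n)\<^sup>2)"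
  proof (rule eventually_mono[OF ev])
    fix n
    assume "\<forall>k Fs. packing n k (card (verts F)) Fs \<longrightarrow> c * n\<^sup>2 < k \<longrightarrow>
      (\<forall>i<k. \<exists>h. graph_hom h G (Fs i)) \<longrightarrow>
      (\<exists>\<phi>. inj_on \<phi> (verts G) \<and> (\<forall>e\<in>edges G. \<exists>i<k. \<phi> ` e \<in> edges (Fs i)) \<and>
      (\<forall>i<k. \<forall>e\<in>edges G. \<forall>e'\<in>edges G.
        \<phi> ` e \<in> edges (Fs i) \<longrightarrow> \<phi> ` e' \<in> edges (Fs i) \<longrightarrow> e = e'))"
    from bound[OF this] show "norm (real (ex_family F n G)) \<le> c * norm ((real n)\<^sup>2)"
      by simp
  qed
qed

end
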